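(* There is an absolute constant $C>0$ such that, for every $k$-armed bandit instance, the Anytime algorithm (which does not know $T$) satisfies, at every sufficiently large round $T$ (i.e. $T\ge T_0(k)$), $$\textsc{NR}_T\le C\sqrt{\frac{k\log T}{T}}\,\log T.$$
   Context: Stochastic multi-armed bandit: $k$ arms, arm $i$ a distribution on $[0,1]$ with mean $\mu_i$, $\mu^*:=\max_i\mu_i$; in round $t$ the algorithm pulls $I_t\in[k]$ and observes an independent reward from arm $I_t$. Nash regret after $T$ rounds: $\textsc{NR}_T:=\mu^*-\big(\prod_{t=1}^T \mathbb{E}[\mu_{I_t}]\big)^{1/T}$. $\log$ is the natural logarithm. Modified NCB algorithm (inputs $k$, window $W$; constant $c=3$): maintain counts $n_i$ and empirical means $\widehat\mu_i$ (both initially $0$), round index $t=1$. Phase 1: while $\max_i n_i\widehat\mu_i\le 420c^2\log W$ and $t\le W$, pull a uniformly random arm, update, increment $t$. Phase 2: while $t\le W$, pull an arm maximizing $\overline{\mathrm{NCB}}_i:=\widehat\mu_i+2c\sqrt{2\widehat\mu_i\log W/n_i}$, update, increment $t$. Anytime algorithm (input $k$): set $W=1$. Repeat (each repetition is an epoch) until the process stops: with probability $1/W^2$, pull uniformly random arms for $W$ rounds; otherwise (probability $1-1/W^2$) execute a fresh run of Modified NCB$(k,W)$ for $W$ rounds; then set $W\leftarrow 2W$. *)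

theory Defs
  imports "HOL-Probability.Probability"
begin

definition bandit_instance :: "nat \<Rightarrow> (nat \<Rightarrow> real measure) \<Rightarrow> bool" where
  "bandit_instance k \<nu> \<longleftrightarrow>
     (\<forall>i<k. prob_space (\<nu> i) \<and> sets (\<nu> i) = sets borel \<and> (AE x in \<nu> i. x \<in> {0..1}))"

definition arm_mean :: "(nat \<Rightarrow> real measure) \<Rightarrow> nat \<Rightarrow> real" where
  "arm_mean \<nu> i = (\<integral>x. x \<partial>\<nu> i)"

definition opt_mean :: "nat \<Rightarrow> (nat \<Rightarrow> real measure) \<Rightarrow> real" where
  "opt_mean k \<nu> = Max (arm_mean \<nu> ` {..<k})"

text \<open>All randomness is drawn up front (reward-table model):
  Rew i j : the reward observed at the j-th pull (0-based, counted over the whole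
            run) of arm i, distributed as nu i; all independent;
  ArmU t  : a uniform [0,1] variable used for the uniformly random arm in round t+1;
  Coin e  : a uniform [0,1] variable deciding the mode of epoch e (W = 2^e).\<close>

datatype src = Rew nat nat | ArmU nat | Coin nat

definition sample_space :: "nat \<Rightarrow> (nat \<Rightarrow> real measure) \<Rightarrow> (src \<Rightarrow> real) measure" where
  "sample_space k \<nu> = PiM UNIV (\<lambda>x. case x of
        Rew i j \<Rightarrow> (if i < k then \<nu> i else return borel 0)
      | ArmU t \<Rightarrow> uniform_measure lborel {0..1}
      | Coin e \<Rightarrow> uniform_measure lborel {0..1})"

definition unif_arm :: "nat \<Rightarrow> real \<Rightarrow> nat" where
  "unif_arm k u = min (k - 1) (nat \<lfloor>real k * u\<rfloor>)"

definition ncb_c :: real where "ncb_c = 3"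

record st =
  ep   :: nat              \<comment> \<open>current epoch index e; window W = 2^e\<close>
  pos  :: nat              \<comment> \<open>number of rounds already played in the current epoch\<close>
  cnt  :: "nat \<Rightarrow> nat"     \<comment> \<open>n_i of the current Modified NCB run\<close>
  sm   :: "nat \<Rightarrow> real"    \<comment> \<open>sum of rewards of arm i in the current run (n_i * mu_hat_i)\<close>
  ph2  :: bool             \<comment> \<open>whether the current run has left Phase 1\<close>
  gcnt :: "nat \<Rightarrow> nat"     \<comment> \<open>total number of pulls of arm i so far (reward-table index)\<close>

definition init_st :: st where
  "init_st = \<lparr>ep = 0, pos = 0, cnt = (\<lambda>_. 0), sm = (\<lambda>_. 0), ph2 = False, gcnt = (\<lambda>_. 0)\<rparr>"

definition win :: "st \<Rightarrow> nat" where "win s = 2 ^ ep s"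

definition emp_mean :: "st \<Rightarrow> nat \<Rightarrow> real" where
  "emp_mean s i = sm s i / real (cnt s i)"   \<comment> \<open>= 0 when n_i = 0, as initialised\<close>

definition ncb_index :: "st \<Rightarrow> nat \<Rightarrow> real" where
  "ncb_index s i = emp_mean s i
     + 2 * ncb_c * sqrt (2 * emp_mean s i * ln (real (win s)) / real (cnt s i))"

definition phase1_cond :: "nat \<Rightarrow> st \<Rightarrow> bool" where
  "phase1_cond k s \<longleftrightarrow>
     Max ((\<lambda>i. real (cnt s i) * emp_mean s i) ` {..<k}) \<le> 420 * ncb_c^2 * ln (real (win s))"

definition unif_epoch :: "(src \<Rightarrow> real) \<Rightarrow> nat \<Rightarrow> bool" where
  "unif_epoch \<omega> e \<longleftrightarrow> \<omega> (Coin e) < 1 / (2 ^ e)\<^sup>2"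

definition in_phase1 :: "nat \<Rightarrow> st \<Rightarrow> bool" where
  "in_phase1 k s \<longleftrightarrow> \<not> ph2 s \<and> phase1_cond k s"

text \<open>Arm pulled in round t+1 (t = 0,1,...) from state s. Ties in the NCB
  maximisation are broken towards the smallest index.\<close>
definition choose_arm :: "nat \<Rightarrow> (src \<Rightarrow> real) \<Rightarrow> nat \<Rightarrow> st \<Rightarrow> nat" where
  "choose_arm k \<omega> t s =
     (if unif_epoch \<omega> (ep s) \<or> in_phase1 k s then unif_arm k (\<omega> (ArmU t))
      else (LEAST i. i < k \<and> (\<forall>j<k. ncb_index s j \<le> ncb_index s i)))"

definition step :: "nat \<Rightarrow> (src \<Rightarrow> real) \<Rightarrow> nat \<Rightarrow> st \<Rightarrow> st" where
  "step k \<omega> t s =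
     (let a = choose_arm k \<omega> t s;
          r = \<omega> (Rew a (gcnt s a));
          s' = s\<lparr>cnt := (cnt s)(a := Suc (cnt s a)),
                 sm := (sm s)(a := sm s a + r),
                 ph2 := \<not> in_phase1 k s,
                 gcnt := (gcnt s)(a := Suc (gcnt s a)),
                 pos := Suc (pos s)\<rparr>
      in if Suc (pos s) = win s
         then s'\<lparr>ep := Suc (ep s), pos := 0, cnt := (\<lambda>_. 0), sm := (\<lambda>_. 0), ph2 := False\<rparr>
         else s')"

primrec state_at :: "nat \<Rightarrow> (src \<Rightarrow> real) \<Rightarrow> nat \<Rightarrow> st" where
  "state_at k \<omega> 0 = init_st"
| "state_at k \<omega> (Suc t) = step k \<omega> t (state_at k \<omega> t)"

definition pulled :: "nat \<Rightarrow> (src \<Rightarrow> real) \<Rightarrow> nat \<Rightarrow> nat" where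
  "pulled k \<omega> t = choose_arm k \<omega> t (state_at k \<omega> t)"

definition nash_regret :: "nat \<Rightarrow> (nat \<Rightarrow> real measure) \<Rightarrow> nat \<Rightarrow> real" where
  "nash_regret k \<nu> T =
     opt_mean k \<nu>
     - (\<Prod>t<T. \<integral>\<omega>. arm_mean \<nu> (pulled k \<omega> t) \<partial>sample_space k \<nu>) powr (1 / real T)"

end

theory Submission
  imports Defs "HOL-Real_Asymp.Real_Asymp"
begin

text \<open>
  The factor log T in the bound reduces the Nash regret to the ordinary regret. Because of the uniform
  epochs, the ratio y of E[mu(I_t)] to the optimal mean is at least 1 / (k T^2) in every round t,
  so that - ln y \<le> 6 ln T (1 - y); with exp x \<ge> 1 + x this yields
  NR_T \<le> 6 (ln T / T) R_T, where R_T is the expected ordinary regret.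

  It remains to see that R_T = O(sqrt (k T log T)), epoch by epoch. In an epoch of length W, outside an
  event of probability O(k / W^4), exponential tail bounds hold simultaneously for all segments of the
  reward table and for the arm counts under uniform sampling. On this event, with L = ln W, Phase 1 has
  length O(k L) over the optimal mean, hence regret O(k L); when it ends, the rewards of the
  optimal arm already sum to a large multiple of L. From then on the index of the optimal arm dominates
  its mean, a pulled arm with n previous pulls has gap O(sqrt (L / n)), and Phase 2 costs
  O(sqrt (k W L)). Summing over the geometrically growing epochs gives the claim.
\<close>

section \<open>Exponential tail bounds\<close>

text \<open>The right-hand side times \<open>1 + y + y^2 / 2\<close> equals
  \<open>1 + y^4 / 4\<close>, and this second factor is at most \<open>exp y\<close>.\<close>

lemma exp_minus_le_quadratic:
  fixes y :: real
  assumes "0 \<le> y"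
  shows "exp (- y) \<le> 1 - y + y\<^sup>2 / 2"
proof -
  have "1 \<le> (1 - y + y\<^sup>2 / 2) * (1 + y + y\<^sup>2 / 2)"
    by (simp add: algebra_simps power2_eq_square assms)
  also have "\<dots> \<le> (1 - y + y\<^sup>2 / 2) * exp y"
  proof (rule mult_left_mono)
    show "1 + y + y\<^sup>2 / 2 \<le> exp y"
      using exp_lower_Taylor_quadratic[OF assms] .
    have "0 \<le> ((1 - y)\<^sup>2 + 1) / 2" by simp
    then show "0 \<le> 1 - y + y\<^sup>2 / 2" by (simp add: power2_eq_square field_simps)
  qed
  finally show ?thesis by (simp add: exp_minus field_simps)
qed

text \<open>Because \<open>x\<^sup>2 \<le> x\<close> on [0,1], the quadratic Taylor term can be made
  linear in \<open>x\<close>. A bound affine in \<open>x\<close> lets the moment generating function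
  be estimated through the mean alone, so that small means get small fluctuations.\<close>

lemma exp_le_chord_upper:
  fixes l x :: real
  assumes "0 \<le> l" "l \<le> 1" "0 \<le> x" "x \<le> 1"
  shows "exp (l * x) \<le> 1 + (l + l\<^sup>2) * x"
proof -
  have "l * x \<le> 1" using assms by (simp add: mult_le_one)
  then have "exp (l * x) \<le> 1 + l * x + (l * x)\<^sup>2"
    using assms by (intro exp_bound) auto
  also have "(l * x)\<^sup>2 \<le> l\<^sup>2 * x"
    using assms mult_left_mono[of "x\<^sup>2" x "l\<^sup>2"]
    by (simp only: power_mult_distrib) (simp add: power2_eq_square mult_left_le)
  finally show ?thesis by (simp add: algebra_simps)
qed

lemma exp_le_chord_lower:
  fixes l x :: real
  assumes "0 \<le> l" "0 \<le> x" "x \<le> 1"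
  shows "exp (- l * x) \<le> 1 + (l\<^sup>2 / 2 - l) * x"
proof -
  have "exp (- (l * x)) \<le> 1 - l * x + (l * x)\<^sup>2 / 2"
    using assms by (intro exp_minus_le_quadratic) auto
  also have "(l * x)\<^sup>2 \<le> l\<^sup>2 * x"
    using assms mult_left_mono[of "x\<^sup>2" x "l\<^sup>2"]
    by (simp only: power_mult_distrib) (simp add: power2_eq_square mult_left_le)
  finally show ?thesis by (simp add: algebra_simps)
qed

text \<open>Chernoff's method with the affine bound \<open>chord\<close> as its only analytic input.
  The sign of \<open>\<theta>\<close> is free, so one statement serves both tails.\<close>

lemma (in prob_space) exponential_Markov:
  fixes X :: "'i \<Rightarrow> 'a \<Rightarrow> real"
  assumes J: "finite J" and ind: "indep_vars (\<lambda>_. borel) X J"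
    and bnd: "\<And>j. j \<in> J \<Longrightarrow> AE \<omega> in M. X j \<omega> \<in> {0..1}"
    and mean: "\<And>j. j \<in> J \<Longrightarrow> expectation (X j) = p"
    and chord: "\<And>x. 0 \<le> x \<Longrightarrow> x \<le> 1 \<Longrightarrow> exp (\<theta> * x) \<le> 1 + \<psi> * x"
  shows "prob {\<omega> \<in> space M. \<theta> * (\<Sum>j\<in>J. X j \<omega>) > \<psi> * (real (card J) * p) + a} \<le> exp (- a)"
proof -
  have rv[measurable]: "X j \<in> borel_measurable M" if "j \<in> J" for j
    using ind that unfolding indep_vars_def by auto
  have int: "integrable M (\<lambda>\<omega>. exp (\<theta> * X j \<omega>))" if j: "j \<in> J" for j
  proof (rule integrable_const_bound[where B = "exp \<bar>\<theta>\<bar>"])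
    show "AE \<omega> in M. norm (exp (\<theta> * X j \<omega>)) \<le> exp \<bar>\<theta>\<bar>"
      using bnd[OF j]
    proof eventually_elim
      case (elim \<omega>)
      have "\<theta> * X j \<omega> \<le> \<bar>\<theta>\<bar> * X j \<omega>" using elim by (intro mult_right_mono) auto
      also have "\<dots> \<le> \<bar>\<theta>\<bar> * 1" using elim by (intro mult_left_mono) auto
      finally show ?case by simp
    qed
  qed (use j in measurable)
  have intX: "integrable M (X j)" if j: "j \<in> J" for j
    by (rule integrable_const_bound[where B = 1]) (use bnd[OF j] j in auto)
  have mgf: "expectation (\<lambda>\<omega>. exp (\<theta> * X j \<omega>)) \<le> exp (\<psi> * p)" if j: "j \<in> J" for j
  proof -
    have "expectation (\<lambda>\<omega>. exp (\<theta> * X j \<omega>)) \<le> expectation (\<lambda>\<omega>. 1 + \<psi> * X j \<omega>)"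
      by (rule integral_mono_AE[OF int[OF j]]) (use bnd[OF j] chord intX[OF j] in auto)
    also have "\<dots> = 1 + \<psi> * p"
      using intX[OF j] mean[OF j] by (simp add: prob_space)
    also have "\<dots> \<le> exp (\<psi> * p)" by (rule exp_ge_add_one_self)
    finally show ?thesis .
  qed
  have ind': "indep_vars (\<lambda>_. borel) (\<lambda>j \<omega>. exp (\<theta> * X j \<omega>)) J"
    by (rule indep_vars_compose2[OF ind]) auto
  have intp: "integrable M (\<lambda>\<omega>. \<Prod>j\<in>J. exp (\<theta> * X j \<omega>))"
    by (rule indep_vars_integrable[OF J ind' int])
  have "expectation (\<lambda>\<omega>. \<Prod>j\<in>J. exp (\<theta> * X j \<omega>)) = (\<Prod>j\<in>J. expectation (\<lambda>\<omega>. exp (\<theta> * X j \<omega>)))"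
    by (rule indep_vars_lebesgue_integral[OF J ind' int])
  also have "\<dots> \<le> (\<Prod>j\<in>J. exp (\<psi> * p))"
    by (intro prod_mono) (auto intro: mgf)
  also have "\<dots> = exp (\<psi> * (real (card J) * p))"
    by (simp add: exp_of_nat_mult[symmetric] algebra_simps)
  finally have E: "expectation (\<lambda>\<omega>. \<Prod>j\<in>J. exp (\<theta> * X j \<omega>)) \<le> exp (\<psi> * (real (card J) * p))" .
  let ?c = "exp (\<psi> * (real (card J) * p) + a)"
  have "prob {\<omega> \<in> space M. \<theta> * (\<Sum>j\<in>J. X j \<omega>) > \<psi> * (real (card J) * p) + a}
     \<le> prob {\<omega> \<in> space M. (\<Prod>j\<in>J. exp (\<theta> * X j \<omega>)) \<ge> ?c}"
    by (intro finite_measure_mono) (auto simp: exp_sum[OF J, symmetric] sum_distrib_left)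
  also have "\<dots> \<le> expectation (\<lambda>\<omega>. \<Prod>j\<in>J. exp (\<theta> * X j \<omega>)) / ?c"
    by (rule integral_Markov_inequality_measure[OF intp sets.top]) (auto intro!: prod_nonneg)
  also have "\<dots> \<le> exp (\<psi> * (real (card J) * p)) / ?c"
    by (intro divide_right_mono E) simp
  also have "\<dots> = exp (- a)" by (simp add: exp_add exp_minus field_simps)
  finally show ?thesis .
qed

lemma (in prob_space) prob_UN_le_card:
  assumes "finite I" "\<And>i. i \<in> I \<Longrightarrow> A i \<in> events" "\<And>i. i \<in> I \<Longrightarrow> prob (A i) \<le> b"
  shows "prob (\<Union>i\<in>I. A i) \<le> real (card I) * b"
proof -
  have "prob (\<Union>i\<in>I. A i) \<le> (\<Sum>i\<in>I. prob (A i))"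
    using assms by (intro finite_measure_subadditive_finite) auto
  also have "\<dots> \<le> (\<Sum>i\<in>I. b)" by (intro sum_mono assms)
  finally show ?thesis by simp
qed

lemma prob_space_uniform01: "prob_space (uniform_measure lborel {0..1::real})"
  by (rule prob_space_uniform_measure) auto

text \<open>The set is described only below 1, because \<open>unif_arm\<close> breaks its pattern at
  \<open>u = 1\<close>, where the cut at \<open>k - 1\<close> takes effect; this point is
  null.\<close>

lemma measure_uniform01:
  fixes a b :: real
  assumes "A \<in> sets borel" "0 \<le> a" "a \<le> b" "b \<le> 1"
    "\<And>u. 0 \<le> u \<Longrightarrow> u < 1 \<Longrightarrow> u \<in> A \<longleftrightarrow> a \<le> u \<and> u < b"
  shows "measure (uniform_measure lborel {0..1::real}) A = b - a"
proof -
  have "AE u in lborel. u \<noteq> (1::real)" by (rule AE_lborel_singleton)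
  then have "AE u in lborel. (u \<in> {0..1} \<inter> A) = (u \<in> {a..<b})"
    by eventually_elim (use assms(2-4) assms(5) in \<open>auto simp: less_le\<close>)
  then have "measure lborel ({0..1} \<inter> A) = measure lborel {a..<b}"
    using assms by (intro measure_eq_AE) auto
  then show ?thesis using assms by (simp add: measure_uniform_measure)
qed

section \<open>The reward table\<close>

definition src_dist :: "nat \<Rightarrow> (nat \<Rightarrow> real measure) \<Rightarrow> src \<Rightarrow> real measure" where
  "src_dist k \<nu> = (\<lambda>x. case x of
        Rew i j \<Rightarrow> (if i < k then \<nu> i else return borel 0)
      | ArmU t \<Rightarrow> uniform_measure lborel {0..1}
      | Coin e \<Rightarrow> uniform_measure lborel {0..1})"

lemma src_dist_simps:
  "i < k \<Longrightarrow> src_dist k \<nu> (Rew i j) = \<nu> i"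
  "\<not> i < k \<Longrightarrow> src_dist k \<nu> (Rew i j) = return borel 0"
  "src_dist k \<nu> (ArmU t) = uniform_measure lborel {0..1}"
  "src_dist k \<nu> (Coin e) = uniform_measure lborel {0..1}"
  by (simp_all add: src_dist_def)

lemma sample_space_eq_PiM: "sample_space k \<nu> = PiM UNIV (src_dist k \<nu>)"
  by (simp add: sample_space_def src_dist_def)

locale bandit =
  fixes k :: nat and \<nu> :: "nat \<Rightarrow> real measure"
  assumes k_pos: "1 \<le> k" and inst: "bandit_instance k \<nu>"
begin

abbreviation "\<Omega> \<equiv> sample_space k \<nu>"
abbreviation "\<mu> \<equiv> arm_mean \<nu>"
abbreviation "\<mu>s \<equiv> opt_mean k \<nu>"

lemma arm_space:
  assumes "i < k"
  shows "prob_space (\<nu> i)" "sets (\<nu> i) = sets borel" "AE x in \<nu> i. x \<in> {0..1}"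
  using inst assms by (auto simp: bandit_instance_def)

lemma sets_src_dist[measurable_cong]: "sets (src_dist k \<nu> x) = sets borel"
  by (cases x) (auto simp: src_dist_def arm_space split: if_splits)

lemma prob_space_src_dist: "prob_space (src_dist k \<nu> x)"
  by (cases x) (auto simp: src_dist_def arm_space prob_space_uniform01 intro: prob_space_return)

sublocale prob_space \<Omega>
  unfolding sample_space_eq_PiM by (rule prob_space_PiM) (rule prob_space_src_dist)

lemma space_sample_space[simp]: "space \<Omega> = UNIV"
  using sets_eq_imp_space_eq[OF sets_src_dist]
  by (auto simp: sample_space_eq_PiM space_PiM)

lemma measurable_coord[measurable]: "(\<lambda>\<omega>. \<omega> x) \<in> borel_measurable \<Omega>"
proof -
  have "(\<lambda>\<omega>. \<omega> x) \<in> measurable \<Omega> (src_dist k \<nu> x)"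
    unfolding sample_space_eq_PiM by (rule measurable_component_singleton) simp
  then show ?thesis by (simp cong: measurable_cong_sets add: sets_src_dist)
qed

lemma distr_coord: "distr \<Omega> (src_dist k \<nu> x) (\<lambda>\<omega>. \<omega> x) = src_dist k \<nu> x"
  unfolding sample_space_eq_PiM
  by (rule distr_PiM_component) (auto intro: prob_space_src_dist)

lemma measurable_coord_dist: "(\<lambda>\<omega>. \<omega> x) \<in> measurable \<Omega> (src_dist k \<nu> x)"
  using measurable_coord by (simp cong: measurable_cong_sets add: sets_src_dist)

lemma expectation_coord:
  fixes f :: "real \<Rightarrow> real"
  assumes "f \<in> borel_measurable borel"
  shows "expectation (\<lambda>\<omega>. f (\<omega> x)) = (\<integral>y. f y \<partial>src_dist k \<nu> x)"
proof -
  have "f \<in> borel_measurable (src_dist k \<nu> x)"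
    using assms measurable_cong_sets[OF sets_src_dist refl] by blast
  from integral_distr[OF measurable_coord_dist this] show ?thesis
    by (simp only: distr_coord)
qed

lemma AE_coord:
  assumes "AE y in src_dist k \<nu> x. P y"
  shows "AE \<omega> in \<Omega>. P (\<omega> x)"
  using assms unfolding sample_space_eq_PiM
  by (intro AE_PiM_component) (auto intro: prob_space_src_dist)

text \<open>The joint map of all coordinates is the identity, so its law is the product measure
  itself, which is the product of the marginals.\<close>

lemma indep_coords: "indep_vars (\<lambda>_. borel) (\<lambda>x \<omega>. \<omega> x) UNIV"
proof -
  have "indep_vars (src_dist k \<nu>) (\<lambda>x \<omega>. \<omega> x) UNIV"
  proof (subst indep_vars_iff_distr_eq_PiM')
    show "random_variable (src_dist k \<nu> x) (\<lambda>\<omega>. \<omega> x)" for x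
      by (rule measurable_coord_dist)
    have "distr \<Omega> (PiM UNIV (src_dist k \<nu>)) (\<lambda>\<omega>. \<lambda>x\<in>UNIV. \<omega> x) = \<Omega>"
      by (simp add: sample_space_eq_PiM[symmetric] restrict_UNIV distr_id[unfolded id_def])
    also have "\<dots> = PiM UNIV (\<lambda>x. distr \<Omega> (src_dist k \<nu> x) (\<lambda>\<omega>. \<omega> x))"
      by (simp add: distr_coord sample_space_eq_PiM[symmetric])
    finally show "distr \<Omega> (PiM UNIV (src_dist k \<nu>)) (\<lambda>\<omega>. \<lambda>x\<in>UNIV. \<omega> x)
      = PiM UNIV (\<lambda>x. distr \<Omega> (src_dist k \<nu> x) (\<lambda>\<omega>. \<omega> x))" .
  qed auto
  then show ?thesis
    by (rule indep_vars_compose2[where Y = "\<lambda>_ x. x" and N = "\<lambda>_. borel", simplified])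
       (auto cong: measurable_cong_sets simp: sets_src_dist)
qed

text \<open>The injection \<open>s\<close> selects the independent coordinates: the rewards of one
  arm from some offset on, or the uniform draws of consecutive rounds.\<close>

lemma coords_exponential_Markov:
  fixes s :: "nat \<Rightarrow> src" and f :: "real \<Rightarrow> real"
  assumes s: "inj s" and f[measurable]: "f \<in> borel_measurable borel"
    and bnd: "\<And>j. AE \<omega> in \<Omega>. f (\<omega> (s j)) \<in> {0..1}"
    and mean: "\<And>j. expectation (\<lambda>\<omega>. f (\<omega> (s j))) = p"
    and chord: "\<And>x. 0 \<le> x \<Longrightarrow> x \<le> 1 \<Longrightarrow> exp (\<theta> * x) \<le> 1 + \<psi> * x"
  shows "prob {\<omega>. \<theta> * (\<Sum>j<n. f (\<omega> (s j))) > \<psi> * (real n * p) + a} \<le> exp (- a)"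
proof -
  have "indep_vars (\<lambda>_. borel) (\<lambda>x \<omega>. f (\<omega> x)) (s ` {..<n})"
    by (rule indep_vars_compose2[OF indep_vars_subset[OF indep_coords]]) auto
  from exponential_Markov[OF _ this _ _ chord, of p a]
  have "prob {\<omega>. \<theta> * (\<Sum>x\<in>s ` {..<n}. f (\<omega> x)) > \<psi> * (real (card (s ` {..<n})) * p) + a} \<le> exp (- a)"
    using bnd mean by auto
  moreover have "inj_on s {..<n}" using s by (rule inj_on_subset) simp
  ultimately show ?thesis by (simp add: sum.reindex card_image)
qed

lemma expectation_reward:
  assumes "i < k"
  shows "expectation (\<lambda>\<omega>. \<omega> (Rew i j)) = \<mu> i"
  using expectation_coord[of "\<lambda>x. x" "Rew i j", OF measurable_ident_sets[OF refl]]
  unfolding src_dist_simps(1)[OF assms] arm_mean_def .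

lemma AE_reward:
  assumes "i < k"
  shows "AE \<omega> in \<Omega>. \<omega> (Rew i j) \<in> {0..1}"
  by (rule AE_coord[where P = "\<lambda>y. y \<in> {0..1}"])
     (unfold src_dist_simps(1)[OF assms], rule arm_space(3)[OF assms])

lemma arm_mean_bounds:
  assumes "i < k"
  shows "0 \<le> \<mu> i" "\<mu> i \<le> 1"
proof -
  interpret N: prob_space "\<nu> i" by (rule arm_space[OF assms])
  have [measurable]: "(\<lambda>x. x) \<in> borel_measurable (\<nu> i)"
    using arm_space(2)[OF assms] by (simp cong: measurable_cong_sets)
  have AE: "AE x in \<nu> i. x \<in> {0..1}" by (rule arm_space[OF assms])
  show "0 \<le> \<mu> i" unfolding arm_mean_def
    by (rule integral_nonneg_AE) (use AE in auto)
  have "integrable (\<nu> i) (\<lambda>x. x)"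
    by (rule N.integrable_const_bound[where B = 1]) (use AE in auto)
  then have "(\<integral>x. x \<partial>\<nu> i) \<le> (\<integral>x. 1 \<partial>\<nu> i)"
    by (rule integral_mono_AE) (use AE in auto)
  then show "\<mu> i \<le> 1" by (simp add: arm_mean_def N.prob_space)
qed

lemma arm_mean_le_opt: "i < k \<Longrightarrow> \<mu> i \<le> \<mu>s"
  unfolding opt_mean_def by (intro Max_ge) auto

lemma opt_arm_exists: obtains i where "i < k" "\<mu> i = \<mu>s"
proof -
  have "Max (\<mu> ` {..<k}) \<in> \<mu> ` {..<k}" using k_pos by (intro Max_in) (auto simp: lessThan_empty_iff)
  then show ?thesis using that by (auto simp: opt_mean_def)
qed

lemma opt_mean_bounds: "0 \<le> \<mu>s" "\<mu>s \<le> 1"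
  by (metis arm_mean_bounds(1) opt_arm_exists, metis arm_mean_bounds(2) opt_arm_exists)

lemma unif_arm_less: "unif_arm k u < k"
  using k_pos by (auto simp: unif_arm_def)

lemma measurable_unif_arm[measurable]: "unif_arm k \<in> measurable borel (count_space UNIV)"
  unfolding unif_arm_def by measurable

lemma unif_arm_eq_iff:
  assumes "0 \<le> u" "u < 1" "i < k"
  shows "unif_arm k u = i \<longleftrightarrow> real i / k \<le> u \<and> u < (real i + 1) / k"
proof -
  have "nat \<lfloor>real k * u\<rfloor> < k"
    using assms k_pos by (auto simp: nat_less_iff floor_less_iff)
  then have "unif_arm k u = nat \<lfloor>real k * u\<rfloor>" by (auto simp: unif_arm_def)
  also have "\<dots> = i \<longleftrightarrow> \<lfloor>real k * u\<rfloor> = int i"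
    using assms by (auto simp: nat_eq_iff)
  also have "\<dots> \<longleftrightarrow> real i / k \<le> u \<and> u < (real i + 1) / k"
    using assms k_pos by (auto simp: floor_eq_iff field_simps)
  finally show ?thesis .
qed

lemma prob_coord:
  assumes "A \<in> sets borel"
  shows "prob {\<omega>. \<omega> x \<in> A} = measure (src_dist k \<nu> x) A"
proof -
  have "measure (distr \<Omega> (src_dist k \<nu> x) (\<lambda>\<omega>. \<omega> x)) A = prob {\<omega>. \<omega> x \<in> A}"
    using assms measurable_coord_dist
    by (subst measure_distr) (auto simp: sets_src_dist vimage_def)
  then show ?thesis by (simp only: distr_coord)
qed

lemma prob_unif_arm:
  assumes "i < k"
  shows "prob {\<omega>. unif_arm k (\<omega> (ArmU t)) = i} = 1 / k"
proof -
  let ?A = "{u. unif_arm k u = i}"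
  have A: "?A \<in> sets borel" by measurable
  have "prob {\<omega>. \<omega> (ArmU t) \<in> ?A} = (real i + 1) / k - real i / k"
    unfolding prob_coord[OF A]
    unfolding src_dist_simps by (rule measure_uniform01[OF A])
       (use assms unif_arm_eq_iff in \<open>auto simp: field_simps\<close>)
  then show ?thesis by (simp add: diff_divide_distrib[symmetric])
qed

lemma prob_unif_epoch: "prob {\<omega>. unif_epoch \<omega> e} = 1 / (2 ^ e)\<^sup>2"
proof -
  let ?A = "{u::real. u < 1 / (2 ^ e)\<^sup>2}"
  have A: "?A \<in> sets borel" by measurable
  have "prob {\<omega>. \<omega> (Coin e) \<in> ?A} = 1 / (2 ^ e)\<^sup>2 - 0"
    unfolding prob_coord[OF A]
    unfolding src_dist_simps by (rule measure_uniform01[OF A]) (auto simp: one_le_power)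
  then show ?thesis by (simp add: unif_epoch_def)
qed

lemma prob_unif_epoch_arm:
  assumes "i < k"
  shows "prob {\<omega>. unif_epoch \<omega> e \<and> unif_arm k (\<omega> (ArmU t)) = i} = 1 / (2 ^ e)\<^sup>2 * (1 / k)"
proof -
  \<comment> \<open>Both events are put into one family indexed by coordinates, the form that
    independence of the coordinates speaks about.\<close>
  let ?A = "\<lambda>x. if x = Coin e then {u::real. u < 1 / (2 ^ e)\<^sup>2} else {u. unif_arm k u = i}"
  have A: "?A x \<in> sets borel" for x by (cases "x = Coin e") simp_all
  have "prob (\<Inter>x\<in>{Coin e, ArmU t}. (\<lambda>\<omega>. \<omega> x) -` ?A x \<inter> space \<Omega>)
     = (\<Prod>x\<in>{Coin e, ArmU t}. prob ((\<lambda>\<omega>. \<omega> x) -` ?A x \<inter> space \<Omega>))"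
    by (rule indep_varsD[OF indep_coords]) (use A in auto)
  also have "(\<Inter>x\<in>{Coin e, ArmU t}. (\<lambda>\<omega>. \<omega> x) -` ?A x \<inter> space \<Omega>)
     = {\<omega>. unif_epoch \<omega> e \<and> unif_arm k (\<omega> (ArmU t)) = i}"
    by (auto simp: unif_epoch_def)
  also have "(\<Prod>x\<in>{Coin e, ArmU t}. prob ((\<lambda>\<omega>. \<omega> x) -` ?A x \<inter> space \<Omega>))
     = prob ((\<lambda>\<omega>. \<omega> (Coin e)) -` ?A (Coin e)) * prob ((\<lambda>\<omega>. \<omega> (ArmU t)) -` ?A (ArmU t))"
    by simp
  also have "(\<lambda>\<omega>. \<omega> (Coin e)) -` ?A (Coin e) = {\<omega>. unif_epoch \<omega> e}"
    by (auto simp: unif_epoch_def)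
  also have "(\<lambda>\<omega>. \<omega> (ArmU t)) -` ?A (ArmU t) = {\<omega>. unif_arm k (\<omega> (ArmU t)) = i}"
    by auto
  finally show ?thesis
    by (simp only: prob_unif_epoch prob_unif_arm[OF assms])
qed

end

section \<open>The run of an epoch\<close>

text \<open>Counted from the actions instead of the state: when an epoch ends, \<open>cnt\<close> is
  reset, whereas this count still covers the whole epoch.\<close>

definition pulls :: "nat \<Rightarrow> (src \<Rightarrow> real) \<Rightarrow> nat \<Rightarrow> nat \<Rightarrow> nat \<Rightarrow> nat" where
  "pulls k \<omega> t n i = (\<Sum>m<n. of_bool (pulled k \<omega> (t + m) = i))"

lemma pulls_0[simp]: "pulls k \<omega> t 0 i = 0"
  by (simp add: pulls_def)

lemma pulls_Suc: "pulls k \<omega> t (Suc n) i = pulls k \<omega> t n i + of_bool (pulled k \<omega> (t + n) = i)"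
  by (simp add: pulls_def)

lemma step_sel:
  "ep (step k \<omega> t s) = (if Suc (pos s) = win s then Suc (ep s) else ep s)"
  "pos (step k \<omega> t s) = (if Suc (pos s) = win s then 0 else Suc (pos s))"
  "cnt (step k \<omega> t s) i = (if Suc (pos s) = win s then 0
     else cnt s i + of_bool (choose_arm k \<omega> t s = i))"
  "sm (step k \<omega> t s) i = (if Suc (pos s) = win s then 0
     else sm s i + (if choose_arm k \<omega> t s = i then \<omega> (Rew i (gcnt s i)) else 0))"
  "ph2 (step k \<omega> t s) = (Suc (pos s) \<noteq> win s \<and> \<not> in_phase1 k s)"
  "gcnt (step k \<omega> t s) i = gcnt s i + of_bool (choose_arm k \<omega> t s = i)"
  by (auto simp: step_def Let_def)

lemma gcnt_le: "gcnt (state_at k \<omega> t) i \<le> t"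
  by (induction t) (auto simp: init_st_def step_sel intro: le_SucI)

text \<open>The inequality \<open>n < 2 ^ e\<close> is strict because after \<open>2 ^ e\<close>
  rounds the state is already that of the next epoch. The rewards of an arm within an epoch are
  consecutive table entries, starting at its global count.\<close>

lemma epoch_state:
  assumes "ep (state_at k \<omega> t) = e" "pos (state_at k \<omega> t) = 0" "n < 2 ^ e"
    "\<And>i. cnt (state_at k \<omega> t) i = 0" "\<And>i. sm (state_at k \<omega> t) i = 0"
  shows "ep (state_at k \<omega> (t + n)) = e" (is ?A)
    and "pos (state_at k \<omega> (t + n)) = n" (is ?B)
    and "cnt (state_at k \<omega> (t + n)) i = pulls k \<omega> t n i" (is ?C)
    and "gcnt (state_at k \<omega> (t + n)) i = gcnt (state_at k \<omega> t) i + pulls k \<omega> t n i" (is ?D)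
    and "sm (state_at k \<omega> (t + n)) i
         = (\<Sum>j<pulls k \<omega> t n i. \<omega> (Rew i (gcnt (state_at k \<omega> t) i + j)))" (is ?E)
proof -
  have "?A \<and> ?B \<and> ?C \<and> ?D \<and> ?E"
    using assms(3)
  proof (induction n)
    case 0
    then show ?case using assms by simp
  next
    case (Suc n)
    then show ?case by (auto simp: step_sel win_def pulls_Suc pulled_def)
  qed
  then show ?A ?B ?C ?D ?E by auto
qed

text \<open>The total length 1 + 2 + ... + 2^(e-1) of the earlier epochs.\<close>

definition epoch_time :: "nat \<Rightarrow> nat" where
  "epoch_time e = 2 ^ e - 1"

lemma epoch_time_less: "epoch_time e < 2 ^ e"
  by (simp add: epoch_time_def)

lemma epoch_start:
  "ep (state_at k \<omega> (epoch_time e)) = e \<and> pos (state_at k \<omega> (epoch_time e)) = 0 \<and>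
   (\<forall>i. cnt (state_at k \<omega> (epoch_time e)) i = 0) \<and> (\<forall>i. sm (state_at k \<omega> (epoch_time e)) i = 0) \<and>
   \<not> ph2 (state_at k \<omega> (epoch_time e))"
proof (induction e)
  case 0
  then show ?case by (simp add: init_st_def epoch_time_def)
next
  case (Suc e)
  let ?t = "epoch_time e"
  let ?n = "2 ^ e - 1 :: nat"
  have n: "?n < 2 ^ e" by simp
  have ep: "ep (state_at k \<omega> (?t + ?n)) = e" and pos: "pos (state_at k \<omega> (?t + ?n)) = ?n"
    using epoch_state(1,2)[OF _ _ n, of k \<omega> ?t] Suc by auto
  have w: "Suc (pos (state_at k \<omega> (?t + ?n))) = win (state_at k \<omega> (?t + ?n))"
    unfolding win_def ep pos by simp
  have "epoch_time (Suc e) = Suc (?t + ?n)"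
    using n unfolding epoch_time_def power_Suc by linarith
  then show ?case by (simp only: state_at.simps step_sel w ep) simp
qed

lemmas within_epoch = epoch_state[of _ _ "epoch_time e" e for e, OF
    epoch_start[THEN conjunct1] epoch_start[THEN conjunct2, THEN conjunct1] _
    epoch_start[THEN conjunct2, THEN conjunct2, THEN conjunct1, rule_format]
    epoch_start[THEN conjunct2, THEN conjunct2, THEN conjunct2, THEN conjunct1, rule_format]]

lemma ph2_Suc:
  assumes "Suc n < 2 ^ e"
  shows "ph2 (state_at k \<omega> (epoch_time e + Suc n)) \<longleftrightarrow> \<not> in_phase1 k (state_at k \<omega> (epoch_time e + n))"
proof -
  have n: "n < 2 ^ e" using assms by simp
  have "Suc (pos (state_at k \<omega> (epoch_time e + n))) \<noteq> win (state_at k \<omega> (epoch_time e + n))"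
    unfolding win_def within_epoch(1)[OF n] within_epoch(2)[OF n] using assms by simp
  then show ?thesis by (simp add: step_sel)
qed

section \<open>Two-sided deviation bounds and confidence indices\<close>

text \<open>\<open>S\<close> is a sum of independent variables, \<open>m\<close> its mean and
  \<open>l\<close> the Chernoff tilt. The allowance \<open>6 * L\<close> makes each side fail with
  probability at most \<open>exp (- 6 * L)\<close>. Not dividing by \<open>l\<close> keeps the tilt
  0 admissible.\<close>

definition two_sided :: "real \<Rightarrow> real \<Rightarrow> real \<Rightarrow> real \<Rightarrow> bool" where
  "two_sided l L S m \<longleftrightarrow> l * S \<le> (l + l\<^sup>2) * m + 6 * L \<and> (l - l\<^sup>2 / 2) * m \<le> l * S + 6 * L"

lemma measurable_two_sided[measurable (raw)]:
  assumes "S \<in> borel_measurable M"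
  shows "Measurable.pred M (\<lambda>\<omega>. two_sided l L (S \<omega>) m)"
  using assms unfolding two_sided_def by measurable

lemma two_sided_1D:
  assumes "two_sided 1 L S m"
  shows "S \<le> 2 * m + 6 * L" "m \<le> 2 * S + 12 * L"
  using assms by (auto simp: two_sided_def)

text \<open>The hypothesis on S, a consequence of the stopping rule of Phase 1, is what makes the
  index of the optimal arm an upper confidence bound although it is built from the empirical mean.\<close>

lemma optimism:
  assumes L: "0 < L" and S: "226 * L \<le> S" and 1: "two_sided 1 L S m"
    and l: "two_sided (min 1 (sqrt (12 * L / m))) L S m"
  shows "m \<le> S + 6 * sqrt (2 * S * L)"
proof (cases "m \<le> S")
  case True
  have "0 \<le> S * L" using L S by simp
  then have "0 \<le> 6 * sqrt (2 * S * L)" by (simp add: mult.assoc)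
  then show ?thesis using True by linarith
next
  case False
  define l where "l = sqrt (12 * L / m)"
  have m: "0 < m" "12 * L < m" using False L S by auto
  have l0: "0 < l" using m L by (simp add: l_def)
  have l2: "l\<^sup>2 * m = 12 * L" using m L by (simp add: l_def)
  have "l \<le> 1" using m by (simp add: l_def)
  then have "(l - l\<^sup>2 / 2) * m \<le> l * S + 6 * L"
    using l by (simp add: two_sided_def l_def[symmetric] min_def)
  \<comment> \<open>The tilt balances the errors: \<open>6 * L\<close> equals half of
    \<open>l\<^sup>2 * m\<close>, and so does the quadratic term.\<close>
  then have "l * m \<le> l * S + l\<^sup>2 * m" using l2 by (simp add: algebra_simps)
  then have "l * m \<le> l * (S + l * m)" by (simp add: algebra_simps power2_eq_square)
  then have le: "m \<le> S + l * m" using l0 by simp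
  have "(l * m)\<^sup>2 = 12 * L * m"
    using l2 by (simp add: power2_eq_square)
  also have "\<dots> \<le> 12 * L * (2 * S + 12 * L)"
    using two_sided_1D(2)[OF 1] L by (intro mult_left_mono) auto
  \<comment> \<open>Here \<open>12 * L \<le> 4 * S\<close>. The product \<open>72 * S * L\<close> is
    the square of the number of pulls times the confidence width, whose factor is
    \<open>2 * ncb_c = 6\<close>.\<close>
  also have "\<dots> \<le> 12 * L * (6 * S)"
    using L S by (intro mult_left_mono) auto
  also have "\<dots> = (6 * sqrt (2 * S * L))\<^sup>2"
    using L S by (simp add: power_mult_distrib)
  finally have "l * m \<le> 6 * sqrt (2 * S * L)"
    using L S by (intro power2_le_imp_le[of "l * m"]) auto
  then show ?thesis using le by simp
qed

text \<open>With \<open>l\<^sup>2 * n = 6 * L\<close> and \<open>p \<le> 1\<close>, the quadratic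
  term and the allowance cost at most \<open>l * n\<close> each after division by \<open>l\<close>.
  If the tilt is capped at 1, the right-hand side exceeds 1 and the bound is trivial.\<close>

lemma pessimism:
  fixes n :: nat and S p L :: real
  assumes L: "0 < L" and n: "0 < n" and S: "S \<le> n" and p: "0 \<le> p" "p \<le> 1"
    and l: "two_sided (min 1 (sqrt (6 * L / n))) L S (n * p)"
  shows "S / n \<le> p + 2 * sqrt (6 * L / n)"
proof -
  define l where "l = sqrt (6 * L / n)"
  have l0: "0 < l" using n L by (simp add: l_def)
  have l2: "l\<^sup>2 * n = 6 * L" using n L by (simp add: l_def)
  show ?thesis
  proof (cases "l \<le> 1")
    case True
    then have "l * S \<le> (l + l\<^sup>2) * (n * p) + 6 * L"
      using l by (simp add: two_sided_def l_def[symmetric] min_def)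
    also have "\<dots> = l * (n * p + l * (n * p) + l * n)"
      using l2 by (simp add: algebra_simps power2_eq_square)
    finally have "S \<le> n * p + l * (n * p) + l * n" using l0 by simp
    also have "l * (n * p) \<le> l * n"
      using p l0 by (simp add: mult_left_le)
    finally have "S \<le> n * (p + 2 * l)" by (simp add: algebra_simps)
    then show ?thesis using n by (simp add: l_def field_simps)
  next
    case False
    have "S / n \<le> 1" using S n by simp
    then show ?thesis using False p unfolding l_def by linarith
  qed
qed

text \<open>As the empirical mean is at most 1, the width costs 6 * 1.5 = 9 and the deviation of the
  mean 2 * 2.5 = 5 multiples of \<open>sqrt (L / n)\<close>.\<close>

lemma index_upper:
  fixes n :: nat and S p L :: real
  assumes L: "0 < L" and n: "0 < n" and S: "0 \<le> S" "S \<le> n" and p: "0 \<le> p" "p \<le> 1"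
    and l: "two_sided (min 1 (sqrt (6 * L / n))) L S (n * p)"
  shows "S / n + 6 * sqrt (2 * (S / n) * L / n) \<le> p + 14 * sqrt (L / n)"
proof -
  have "sqrt (2 * (S / n) * L / n) \<le> sqrt (2 * 1 * L / n)"
    using S n L by (intro real_sqrt_le_mono divide_right_mono mult_right_mono mult_left_mono) auto
  also have "\<dots> = sqrt 2 * sqrt (L / n)"
    by (simp add: real_sqrt_mult[symmetric])
  also have "\<dots> \<le> 1.5 * sqrt (L / n)"
    using L by (intro mult_right_mono real_le_lsqrt) (auto simp: power2_eq_square)
  finally have a: "sqrt (2 * (S / n) * L / n) \<le> 1.5 * sqrt (L / n)" .
  have "sqrt (6 * L / n) = sqrt 6 * sqrt (L / n)"
    by (simp add: real_sqrt_mult[symmetric])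
  also have "\<dots> \<le> 2.5 * sqrt (L / n)"
    using L by (intro mult_right_mono real_le_lsqrt) (auto simp: power2_eq_square)
  finally have b: "sqrt (6 * L / n) \<le> 2.5 * sqrt (L / n)" .
  show ?thesis using pessimism[OF L n S(2) p l] a b by simp
qed

text \<open>Bounds the loss of one pull by an increment of the potential
  \<open>40 * sqrt (L * c)\<close>, so that the losses of an arm telescope. The step itself needs 14
  * 2.5 = 35.\<close>

lemma sqrt_potential_step:
  fixes c :: nat and L :: real
  assumes L: "0 \<le> L"
  shows "14 * sqrt (L / c) \<le> 40 * (sqrt (L * (real c + 1)) - sqrt (L * c))"
proof (cases "c = 0")
  case True
  \<comment> \<open>Division by zero makes the left-hand side 0.\<close>
  then show ?thesis using L by simp
next
  case False
  define x where "x = sqrt (real c)"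
  define y where "y = sqrt (real c + 1)"
  have x: "0 < x" using False by (simp add: x_def)
  have y: "y \<le> 1.5 * x"
    unfolding y_def x_def using False
    by (intro real_le_lsqrt) (auto simp: power_mult_distrib power2_eq_square)
  have xy: "x < y" by (simp add: x_def y_def)
  have "(y - x) * (y + x) = y\<^sup>2 - x\<^sup>2" by (simp add: power2_eq_square algebra_simps)
  also have "\<dots> = 1" by (simp add: x_def y_def)
  finally have "1 = (y - x) * (y + x)" by simp
  also have "\<dots> \<le> (y - x) * (2.5 * x)" using xy y by (intro mult_left_mono) auto
  finally have "14 / x \<le> 40 * (y - x)" using x xy by (simp add: field_simps)
  then have "sqrt L * (14 / x) \<le> sqrt L * (40 * (y - x))"
    using L by (intro mult_left_mono) auto
  then show ?thesis
    by (simp add: x_def y_def real_sqrt_mult real_sqrt_divide right_diff_distrib mult_ac)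
qed

lemma sum_sqrt_le:
  fixes c :: "nat \<Rightarrow> real"
  assumes "\<And>i. i < k \<Longrightarrow> 0 \<le> c i"
  shows "(\<Sum>i<k. sqrt (c i)) \<le> sqrt (k * (\<Sum>i<k. c i))"
proof (rule real_le_rsqrt)
  have "(\<Sum>i<k. sqrt (c i) * 1)\<^sup>2 \<le> (\<Sum>i<k. (sqrt (c i))\<^sup>2) * (\<Sum>i<k. 1\<^sup>2)"
    by (rule Cauchy_Schwarz_ineq_sum)
  also have "(\<Sum>i<k. (sqrt (c i))\<^sup>2) = (\<Sum>i<k. c i)"
    using assms by (intro sum.cong) auto
  finally show "(\<Sum>i<k. sqrt (c i))\<^sup>2 \<le> k * (\<Sum>i<k. c i)" by (simp add: mult.commute)
qed

text \<open>The tilt 1 compares sum and mean up to a factor 2 and an additive O(L). The other two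
  minimise the Chernoff exponent for a deviation of order sqrt (L n), respectively sqrt (L n p);
  they degenerate to 0 (and the constraint becomes void) when n or n p vanishes.\<close>

definition tilts :: "real \<Rightarrow> nat \<Rightarrow> real \<Rightarrow> real set" where
  "tilts L n p = {1, min 1 (sqrt (6 * L / n)), min 1 (sqrt (12 * L / (n * p)))}"

lemma finite_tilts: "finite (tilts L n p)" and card_tilts: "card (tilts L n p) \<le> 3"
  by (auto simp: tilts_def card_insert_if)

lemma exp_6_ln: "exp (- (6 * ln (2 ^ e))) = 1 / (2 ^ e :: real) ^ 6"
proof -
  have "exp (6 * ln (2 ^ e :: real)) = (2 ^ e) ^ 6"
    using exp_of_nat_mult[of 6 "ln (2 ^ e :: real)"] by simp
  then show ?thesis by (simp add: exp_minus inverse_eq_divide)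
qed

context bandit
begin

text \<open>The number of pulls of arm i before epoch e is random but less than 2 ^ e. Demanding
  the bound for every starting index g of the reward table turns the adaptive sampling within the
  epoch into a statement about independent sums.\<close>

definition reward_good :: "nat \<Rightarrow> (src \<Rightarrow> real) \<Rightarrow> bool" where
  "reward_good e \<omega> \<longleftrightarrow> (\<forall>i<k. \<forall>g<2 ^ e. \<forall>n\<le>2 ^ e. \<forall>l\<in>tilts (ln (2 ^ e)) n (\<mu> i).
     two_sided l (ln (2 ^ e)) (\<Sum>j<n. \<omega> (Rew i (g + j))) (n * \<mu> i))"

text \<open>The uniform draws are indexed by rounds, so the start of the epoch is a known offset.
  Tilt 1 suffices, since pull counts are needed only up to a constant factor and an additive
  O(L).\<close>

definition arm_good :: "nat \<Rightarrow> (src \<Rightarrow> real) \<Rightarrow> bool" where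
  "arm_good e \<omega> \<longleftrightarrow> (\<forall>i<k. \<forall>n\<le>2 ^ e.
     two_sided 1 (ln (2 ^ e)) (\<Sum>j<n. of_bool (unif_arm k (\<omega> (ArmU (epoch_time e + j))) = i)) (n / k))"

lemma choose_arm_less: "choose_arm k \<omega> t s < k"
  and choose_arm_max: "\<not> unif_epoch \<omega> (ep s) \<Longrightarrow> \<not> in_phase1 k s \<Longrightarrow> j < k \<Longrightarrow>
    ncb_index s j \<le> ncb_index s (choose_arm k \<omega> t s)"
proof -
  let ?m = "Max (ncb_index s ` {..<k})"
  have "?m \<in> ncb_index s ` {..<k}"
    using k_pos by (intro Max_in) (auto simp: lessThan_empty_iff)
  then obtain i where "i < k" "ncb_index s i = ?m" by auto
  then have "i < k \<and> (\<forall>j<k. ncb_index s j \<le> ncb_index s i)" by simp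
  from LeastI[of "\<lambda>i. i < k \<and> (\<forall>j<k. ncb_index s j \<le> ncb_index s i)", OF this]
  show "choose_arm k \<omega> t s < k"
    and "\<not> unif_epoch \<omega> (ep s) \<Longrightarrow> \<not> in_phase1 k s \<Longrightarrow> j < k \<Longrightarrow>
      ncb_index s j \<le> ncb_index s (choose_arm k \<omega> t s)"
    by (auto simp: choose_arm_def unif_arm_less)
qed

lemma pulled_less: "pulled k \<omega> t < k"
  by (simp add: pulled_def choose_arm_less)

lemma sum_pulls: "(\<Sum>i<k. pulls k \<omega> t n i) = n"
proof -
  have "(\<Sum>i<k. pulls k \<omega> t n i) = (\<Sum>m<n. \<Sum>i<k. of_bool (pulled k \<omega> (t + m) = i))"
    unfolding pulls_def by (rule sum.swap)
  also have "\<dots> = (\<Sum>m<n. 1)"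
    using pulled_less by (intro sum.cong) (auto simp: of_bool_def sum.delta)
  finally show ?thesis by simp
qed

end

section \<open>Regret of one epoch at a fixed good sample point\<close>

locale good_epoch = bandit +
  fixes \<omega> :: "src \<Rightarrow> real" and e :: nat
  assumes ncb: "\<not> unif_epoch \<omega> e"
    and rewards: "\<And>i j. i < k \<Longrightarrow> \<omega> (Rew i j) \<in> {0..1}"
    and rg: "reward_good e \<omega>" and ag: "arm_good e \<omega>"
begin

definition "L = ln (2 ^ e :: real)"
abbreviation "t0 \<equiv> epoch_time e"
abbreviation "s n \<equiv> state_at k \<omega> (t0 + n)"
abbreviation "N n i \<equiv> pulls k \<omega> t0 n i"

lemma L_nonneg: "0 \<le> L"
  by (simp add: L_def)

lemma ln_win: "n < 2 ^ e \<Longrightarrow> ln (real (win (s n))) = L"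
  by (simp add: win_def within_epoch L_def)

lemma N_le: "i < k \<Longrightarrow> N n i \<le> n"
  using sum_pulls[of \<omega> t0 n] member_le_sum[of i "{..<k}" "N n"] by simp

lemma sm_mono:
  assumes "m \<le> n" "n < 2 ^ e" "i < k"
  shows "sm (s m) i \<le> sm (s n) i"
proof -
  have "N m i \<le> N n i" unfolding pulls_def using assms by (intro sum_mono2) auto
  moreover have "m < 2 ^ e" using assms by simp
  ultimately show ?thesis using rewards[OF assms(3)] assms
    by (subst (1 2) within_epoch(5)) (auto intro!: sum_mono2)
qed

lemma sm_bounds:
  assumes "n < 2 ^ e" "i < k"
  shows "0 \<le> sm (s n) i" "sm (s n) i \<le> N n i"
proof -
  let ?f = "\<lambda>j. \<omega> (Rew i (gcnt (state_at k \<omega> t0) i + j))"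
  show "0 \<le> sm (s n) i"
    unfolding within_epoch(5)[OF assms(1)] using rewards[OF assms(2)] by (intro sum_nonneg) auto
  have "(\<Sum>j<N n i. ?f j) \<le> (\<Sum>j<N n i. 1)"
    using rewards[OF assms(2)] by (intro sum_mono) auto
  then show "sm (s n) i \<le> N n i"
    unfolding within_epoch(5)[OF assms(1)] by simp
qed

text \<open>The observed rewards form a segment of the table whose offset is at most
  \<open>t0 < 2 ^ e\<close> and whose length is at most \<open>2 ^ e\<close>;
  \<open>reward_good\<close> covers all such segments.\<close>

lemma sm_two_sided:
  assumes "n < 2 ^ e" "i < k" "l \<in> tilts L (N n i) (\<mu> i)"
  shows "two_sided l L (sm (s n) i) (N n i * \<mu> i)"
proof -
  have "gcnt (state_at k \<omega> t0) i < 2 ^ e"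
    using gcnt_le[of k \<omega> t0 i] epoch_time_less[of e] by linarith
  moreover have "N n i \<le> 2 ^ e" using N_le[OF assms(2), of n] assms(1) by linarith
  ultimately show ?thesis
    using rg assms unfolding reward_good_def L_def within_epoch(5)[OF assms(1)] by blast
qed

lemma emp_mean_eq: "n < 2 ^ e \<Longrightarrow> emp_mean (s n) i = sm (s n) i / N n i"
  by (simp add: emp_mean_def within_epoch)

lemma cnt_emp_mean: "n < 2 ^ e \<Longrightarrow> real (cnt (s n) i) * emp_mean (s n) i = sm (s n) i"
  by (simp add: emp_mean_def within_epoch)

text \<open>The constant is 3780 = 420 * 3^2.\<close>

lemma phase1_cond_iff:
  assumes "n < 2 ^ e"
  shows "phase1_cond k (s n) \<longleftrightarrow> (\<forall>i<k. sm (s n) i \<le> 3780 * L)"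
  using k_pos unfolding phase1_cond_def cnt_emp_mean[OF assms] ln_win[OF assms] ncb_c_def
  by (subst Max_le_iff) (auto simp: lessThan_empty_iff)

lemma index_eq:
  assumes "n < 2 ^ e"
  shows "ncb_index (s n) i = sm (s n) i / N n i + 6 * sqrt (2 * (sm (s n) i / N n i) * L / N n i)"
  unfolding ncb_index_def emp_mean_eq[OF assms] ln_win[OF assms] ncb_c_def
  by (simp add: within_epoch[OF assms])

text \<open>The flag \<open>ph2\<close> records whether the previous round was outside Phase 1, so
  Phase 1 is an initial segment of the epoch.\<close>

lemma phase1_downward:
  assumes "in_phase1 k (s n)" "m \<le> n" "n < 2 ^ e"
  shows "in_phase1 k (s m)"
  using assms(2,1,3)
proof (induction n rule: dec_induct)
  case (step n)
  then have "\<not> ph2 (s (Suc n))" by (simp only: in_phase1_def) simp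
  then show ?case using step ph2_Suc[of n e k \<omega>] by (meson Suc_lessD)
qed

lemma N_phase1:
  assumes "\<And>m. m < n \<Longrightarrow> in_phase1 k (s m)"
  shows "real (N n i) = (\<Sum>m<n. of_bool (unif_arm k (\<omega> (ArmU (t0 + m))) = i))"
proof -
  have "pulled k \<omega> (t0 + m) = unif_arm k (\<omega> (ArmU (t0 + m)))" if "m < n" for m
    using assms[OF that] by (simp add: pulled_def choose_arm_def)
  then show ?thesis by (simp add: pulls_def)
qed

lemma N_two_sided:
  assumes "\<And>m. m < n \<Longrightarrow> in_phase1 k (s m)" "n \<le> 2 ^ e" "i < k"
  shows "two_sided 1 L (N n i) (n / k)"
proof -
  have "two_sided 1 (ln (2 ^ e)) (\<Sum>j<n. of_bool (unif_arm k (\<omega> (ArmU (t0 + j))) = i)) (n / k)"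
    using ag assms(2,3) unfolding arm_good_def by simp
  then show ?thesis by (simp only: N_phase1[OF assms(1)] L_def)
qed

text \<open>During Phase 1 the rewards of the optimal arm stay below the threshold, although it gets
  its share of the uniform pulls. Passing from rewards to means gives 2 * 3780 + 12 = 7572, from
  pulls to rounds 2 * 7572 + 12 = 15156.\<close>

lemma phase1_length:
  assumes P: "in_phase1 k (s n)" and n: "n < 2 ^ e"
  shows "n * \<mu>s \<le> k * (15156 * L)"
proof -
  obtain b where b: "b < k" "\<mu> b = \<mu>s" by (rule opt_arm_exists)
  have "sm (s n) b \<le> 3780 * L"
    using P b(1) by (auto simp: in_phase1_def phase1_cond_iff[OF n])
  moreover have "two_sided 1 L (sm (s n) b) (N n b * \<mu>s)"
    using sm_two_sided[OF n b(1), of 1] b by (simp add: tilts_def)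
  ultimately have a: "N n b * \<mu>s \<le> 7572 * L"
    using two_sided_1D(2)[of L "sm (s n) b" "N n b * \<mu>s"] by linarith
  have "two_sided 1 L (N n b) (n / k)"
    using phase1_downward[OF P _ n] n b by (intro N_two_sided) auto
  then have "n / k \<le> 2 * real (N n b) + 12 * L" by (rule two_sided_1D)
  then have "n / k * \<mu>s \<le> (2 * real (N n b) + 12 * L) * \<mu>s"
    using opt_mean_bounds by (intro mult_right_mono) auto
  also have "\<dots> \<le> 2 * (N n b * \<mu>s) + 12 * L * 1"
    unfolding distrib_right using opt_mean_bounds L_nonneg
    by (intro add_mono mult_left_mono) auto
  also have "\<dots> \<le> 15156 * L" using a by linarith
  finally show ?thesis using k_pos by (simp add: field_simps)
qed

lemma phase1_at_0: "in_phase1 k (s 0)"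
  using epoch_start[of k \<omega> e] L_nonneg phase1_cond_iff[of 0] by (simp add: in_phase1_def)

text \<open>Some arm, not necessarily optimal, crosses the threshold at the end of Phase 1. Uniform
  sampling gives the optimal arm a comparable number of pulls, and its mean is no smaller. Four
  comparisons, each losing a factor 2 and O(L), lead from 3780 through 1887, 940 and 464 to
  226.\<close>

lemma phase2_opt_sum:
  assumes P: "\<not> in_phase1 k (s n)" and n: "n < 2 ^ e" and b: "b < k" "\<mu> b = \<mu>s"
  shows "226 * L \<le> sm (s n) b"
proof -
  define \<tau> where "\<tau> = (LEAST n. \<not> in_phase1 k (s n))"
  have \<tau>: "\<not> in_phase1 k (s \<tau>)" "\<tau> \<le> n" "\<And>m. m < \<tau> \<Longrightarrow> in_phase1 k (s m)"
    unfolding \<tau>_def using LeastI[of "\<lambda>n. \<not> in_phase1 k (s n)", OF P]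
      Least_le[of "\<lambda>n. \<not> in_phase1 k (s n)", OF P] not_less_Least by blast+
  then obtain m where m: "\<tau> = Suc m" using phase1_at_0 by (cases \<tau>) auto
  have \<tau>W: "\<tau> < 2 ^ e" using \<tau> n by simp
  \<comment> \<open>The round before \<open>\<tau>\<close> was in Phase 1, so the flag is still
    unset and it is the threshold test that fails at \<open>\<tau>\<close>.\<close>
  have "\<not> ph2 (s \<tau>)" using ph2_Suc[of m e k \<omega>] \<tau>(3)[of m] m \<tau>W by simp
  then have "\<not> phase1_cond k (s \<tau>)" using \<tau>(1) by (simp add: in_phase1_def)
  then obtain i where i: "i < k" "3780 * L < sm (s \<tau>) i"
    unfolding phase1_cond_iff[OF \<tau>W] by force
  have 1: "1 \<in> tilts L x y" for x y by (simp add: tilts_def)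
  note S = two_sided_1D[OF sm_two_sided[OF \<tau>W _ 1]]
  note C = two_sided_1D[OF N_two_sided[OF \<tau>(3) less_imp_le[OF \<tau>W]]]
  have "3780 * L < 2 * (N \<tau> i * \<mu> i) + 6 * L"
    using i S(1)[OF i(1)] by linarith
  also have "N \<tau> i * \<mu> i \<le> N \<tau> i * \<mu>s"
    using arm_mean_le_opt[OF i(1)] by (intro mult_left_mono) auto
  finally have a: "1887 * L < N \<tau> i * \<mu>s" by linarith
  have "N \<tau> i * \<mu>s \<le> (2 * (\<tau> / k) + 6 * L) * \<mu>s"
    using C(1)[OF _ i(1)] opt_mean_bounds by (intro mult_right_mono) auto
  also have "\<dots> \<le> 2 * (\<tau> / k * \<mu>s) + 6 * L * 1"
    unfolding distrib_right using opt_mean_bounds L_nonneg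
    by (intro add_mono mult_left_mono) auto
  finally have c: "940 * L \<le> \<tau> / k * \<mu>s" using a L_nonneg by linarith
  have "\<tau> / k * \<mu>s \<le> (2 * real (N \<tau> b) + 12 * L) * \<mu>s"
    using C(2)[OF _ b(1)] opt_mean_bounds by (intro mult_right_mono) auto
  also have "\<dots> \<le> 2 * (N \<tau> b * \<mu>s) + 12 * L * 1"
    unfolding distrib_right using opt_mean_bounds L_nonneg
    by (intro add_mono mult_left_mono) auto
  finally have "464 * L \<le> N \<tau> b * \<mu>s" using c by linarith
  then have "226 * L \<le> sm (s \<tau>) b"
    using S(2)[OF b(1)] b(2) by simp
  also have "\<dots> \<le> sm (s n) b" by (rule sm_mono[OF \<tau>(2) n b(1)])
  finally show ?thesis .
qed

text \<open>The usual optimism argument: the optimal mean is below the index of its arm, hence below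
  that of the pulled arm, which exceeds the mean of the pulled arm by at most the confidence
  radius.\<close>

lemma phase2_gap:
  assumes P: "\<not> in_phase1 k (s n)" and n: "n < 2 ^ e"
  defines "a \<equiv> pulled k \<omega> (t0 + n)"
  shows "\<mu>s - \<mu> a \<le> 14 * sqrt (L / N n a)"
proof -
  obtain b where b: "b < k" "\<mu> b = \<mu>s" by (rule opt_arm_exists)
  have a: "a < k" unfolding a_def by (rule pulled_less)
  \<comment> \<open>Epoch 0 has a single round, which belongs to Phase 1.\<close>
  have "e \<noteq> 0" using P phase1_at_0 n by (cases e) auto
  then have L: "0 < L" by (simp add: L_def ln_gt_zero)
  have So: "226 * L \<le> sm (s n) b" by (rule phase2_opt_sum[OF P n b])
  have No: "0 < N n b" using sm_bounds(2)[OF n b(1)] So L by (cases "N n b = 0") auto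
  have "N n b * \<mu>s \<le> sm (s n) b + 6 * sqrt (2 * sm (s n) b * L)"
    using sm_two_sided[OF n b(1)] b(2) by (intro optimism[OF L So]) (auto simp: tilts_def)
  then have "\<mu>s \<le> (sm (s n) b + 6 * sqrt (2 * sm (s n) b * L)) / N n b"
    using No by (simp add: field_simps)
  also have "\<dots> = ncb_index (s n) b"
    unfolding index_eq[OF n] using No
    by (simp add: add_divide_distrib real_sqrt_divide real_sqrt_mult)
  also have "\<dots> \<le> ncb_index (s n) a"
    unfolding a_def pulled_def
    using ncb P b(1) within_epoch(1)[OF n] by (intro choose_arm_max) auto
  finally have idx: "\<mu>s \<le> ncb_index (s n) a" .
  show ?thesis
  proof (cases "N n a = 0")
    case True
    \<comment> \<open>An arm not yet pulled has index 0 through division by zero, so here the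
      optimal mean is at most 0.\<close>
    then show ?thesis using idx arm_mean_bounds(1)[OF a] unfolding index_eq[OF n] by simp
  next
    case False
    have "ncb_index (s n) a \<le> \<mu> a + 14 * sqrt (L / N n a)"
      unfolding index_eq[OF n]
      by (rule index_upper[OF L])
        (use False sm_bounds[OF n a] arm_mean_bounds[OF a] sm_two_sided[OF n a] in \<open>auto simp: tilts_def\<close>)
    then show ?thesis using idx by simp
  qed
qed

text \<open>Only the term of the pulled arm changes in the potential on the right, and it grows by
  at least the loss of the round. Pulls of Phase 1 raise the potential too, at no loss.\<close>

lemma phase2_regret:
  assumes "n \<le> 2 ^ e"
  shows "(\<Sum>m<n. of_bool (\<not> in_phase1 k (s m)) * (\<mu>s - \<mu> (pulled k \<omega> (t0 + m))))
     \<le> 40 * (\<Sum>i<k. sqrt (L * N n i))"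
  using assms
proof (induction n)
  case 0
  then show ?case by simp
next
  case (Suc n)
  let ?a = "pulled k \<omega> (t0 + n)"
  have a: "?a \<in> {..<k}" using pulled_less by simp
  have "of_bool (\<not> in_phase1 k (s n)) * (\<mu>s - \<mu> ?a) \<le> 14 * sqrt (L / N n ?a)"
    using phase2_gap[of n] Suc.prems L_nonneg by (cases "in_phase1 k (s n)") auto
  also have "\<dots> \<le> 40 * (sqrt (L * (real (N n ?a) + 1)) - sqrt (L * N n ?a))"
    using sqrt_potential_step[OF L_nonneg, of "N n ?a"] by (simp add: add.commute)
  also have "\<dots> = 40 * (sqrt (L * N (Suc n) ?a) - sqrt (L * N n ?a))"
    by (simp add: pulls_Suc)
  also have "sqrt (L * N (Suc n) ?a) - sqrt (L * N n ?a)
     = (\<Sum>i<k. sqrt (L * N (Suc n) i) - sqrt (L * N n i))"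
    using a by (subst sum.remove[OF finite_lessThan a]) (auto simp: pulls_Suc intro!: sum.neutral)
  finally show ?case using Suc by (simp add: sum_subtractf algebra_simps)
qed

lemma epoch_regret:
  assumes "n \<le> 2 ^ e"
  shows "(\<Sum>m<n. \<mu>s - \<mu> (pulled k \<omega> (t0 + m))) \<le> 15156 * real k * L + 1 + 40 * sqrt (L * k * 2 ^ e)"
proof -
  let ?r = "\<lambda>m. \<mu>s - \<mu> (pulled k \<omega> (t0 + m))"
  let ?P = "{m\<in>{..<n}. in_phase1 k (s m)}"
  have "(\<Sum>m<n. ?r m) = (\<Sum>m<n. of_bool (in_phase1 k (s m)) * ?r m)
    + (\<Sum>m<n. of_bool (\<not> in_phase1 k (s m)) * ?r m)"
    unfolding sum.distrib[symmetric] by (intro sum.cong) auto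
  moreover have "(\<Sum>m<n. of_bool (in_phase1 k (s m)) * ?r m) \<le> 15156 * real k * L + 1"
  proof -
    have "(\<Sum>m<n. of_bool (in_phase1 k (s m)) * ?r m) \<le> (\<Sum>m<n. of_bool (in_phase1 k (s m)) * \<mu>s)"
      using arm_mean_bounds(1) pulled_less by (intro sum_mono) auto
    also have "\<dots> = card ?P * \<mu>s"
      by (simp add: sum_distrib_right[symmetric] of_bool_def sum.If_cases Int_def)
    also have "\<dots> \<le> 15156 * real k * L + 1"
    proof (cases "?P = {}")
      case True
      show ?thesis unfolding True using L_nonneg by simp
    next
      case False
      define \<tau> where "\<tau> = Max ?P"
      have fin: "finite ?P" by simp
      have \<tau>: "\<tau> \<in> ?P" unfolding \<tau>_def by (rule Max_in[OF fin False])
      have "?P \<subseteq> {..\<tau>}" unfolding \<tau>_def using Max_ge[OF fin] by blast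
      \<comment> \<open>Counting from 0, the last round \<open>\<tau>\<close> of Phase 1 is the one
        extra round that yields the summand 1.\<close>
      then have "card ?P \<le> Suc \<tau>" using card_mono[of "{..\<tau>}" ?P] by simp
      then have "card ?P * \<mu>s \<le> (real \<tau> + 1) * \<mu>s"
        using opt_mean_bounds by (intro mult_right_mono) auto
      also have "\<dots> \<le> k * (15156 * L) + 1"
        using phase1_length[of \<tau>] \<tau> assms opt_mean_bounds by (simp add: distrib_right)
      finally show ?thesis by (simp add: algebra_simps)
    qed
    finally show ?thesis .
  qed
  moreover have "(\<Sum>m<n. of_bool (\<not> in_phase1 k (s m)) * ?r m) \<le> 40 * sqrt (L * k * 2 ^ e)"
  proof -
    have "(\<Sum>i<k. sqrt (L * N n i)) \<le> sqrt (k * (\<Sum>i<k. L * N n i))"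
      using L_nonneg by (intro sum_sqrt_le) auto
    also have "(\<Sum>i<k. L * N n i) = L * n"
      using sum_pulls[of \<omega> t0 n] by (simp add: sum_distrib_left[symmetric] flip: of_nat_sum)
    also have "sqrt (k * (L * n)) \<le> sqrt (L * k * 2 ^ e)"
    proof (rule real_sqrt_le_mono)
      have "real n \<le> 2 ^ e" using assms by (metis of_nat_le_iff of_nat_numeral of_nat_power)
      then have "L * k * n \<le> L * k * 2 ^ e" using L_nonneg by (intro mult_left_mono) auto
      then show "k * (L * n) \<le> L * k * 2 ^ e" by (simp add: ac_simps)
    qed
    finally show ?thesis using phase2_regret[OF assms] by linarith
  qed
  ultimately show ?thesis by linarith
qed

end

section \<open>Measurability\<close>

context bandit
begin

lemma prob_UNIV[simp]: "prob UNIV = 1"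
  using prob_space by simp

lemma integrable_indicator_event: "A \<in> events \<Longrightarrow> integrable \<Omega> (indicator A :: _ \<Rightarrow> real)"
  by (intro integrable_real_indicator) (simp_all add: emeasure_eq_measure)

text \<open>Stated componentwise, so that no sigma-algebra on the record type \<open>st\<close> has
  to be chosen.\<close>

definition state_measurable :: "((src \<Rightarrow> real) \<Rightarrow> st) \<Rightarrow> bool" where
  "state_measurable s \<longleftrightarrow>
     (\<lambda>\<omega>. ep (s \<omega>)) \<in> measurable \<Omega> (count_space UNIV) \<and>
     (\<lambda>\<omega>. pos (s \<omega>)) \<in> measurable \<Omega> (count_space UNIV) \<and>
     (\<forall>i. (\<lambda>\<omega>. cnt (s \<omega>) i) \<in> measurable \<Omega> (count_space UNIV)) \<and>
     (\<forall>i. (\<lambda>\<omega>. sm (s \<omega>) i) \<in> borel_measurable \<Omega>) \<and>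
     Measurable.pred \<Omega> (\<lambda>\<omega>. ph2 (s \<omega>)) \<and>
     (\<forall>i. (\<lambda>\<omega>. gcnt (s \<omega>) i) \<in> measurable \<Omega> (count_space UNIV))"

text \<open>The table index of the next reward is itself random; it has only countably many values,
  each selecting a fixed coordinate.\<close>

lemma measurable_coord_at:
  fixes c :: "nat \<Rightarrow> src"
  assumes "f \<in> measurable \<Omega> (count_space UNIV)"
  shows "(\<lambda>\<omega>. \<omega> (c (f \<omega>))) \<in> borel_measurable \<Omega>"
  by (rule measurable_compose_countable[where f = "\<lambda>n \<omega>. \<omega> (c n)", OF _ assms]) measurable

lemma phase1_cond_ball:
  "phase1_cond k s \<longleftrightarrow>
     (\<forall>i<k. real (cnt s i) * emp_mean s i \<le> 420 * ncb_c\<^sup>2 * ln (real (win s)))"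
  unfolding phase1_cond_def using k_pos by (subst Max_le_iff) (auto simp: lessThan_empty_iff)

lemma measurable_policy:
  assumes "state_measurable s"
  shows "Measurable.pred \<Omega> (\<lambda>\<omega>. in_phase1 k (s \<omega>))"
    and "(\<lambda>\<omega>. choose_arm k \<omega> t (s \<omega>)) \<in> measurable \<Omega> (count_space UNIV)"
proof -
  have [measurable]:
    "(\<lambda>\<omega>. ep (s \<omega>)) \<in> measurable \<Omega> (count_space UNIV)"
    "\<And>i. (\<lambda>\<omega>. cnt (s \<omega>) i) \<in> measurable \<Omega> (count_space UNIV)"
    "\<And>i. (\<lambda>\<omega>. sm (s \<omega>) i) \<in> borel_measurable \<Omega>"
    "Measurable.pred \<Omega> (\<lambda>\<omega>. ph2 (s \<omega>))"
    using assms by (auto simp: state_measurable_def)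
  have [measurable]: "(\<lambda>\<omega>. emp_mean (s \<omega>) i) \<in> borel_measurable \<Omega>" for i
    unfolding emp_mean_def by measurable
  have [measurable]: "(\<lambda>\<omega>. ncb_index (s \<omega>) i) \<in> borel_measurable \<Omega>" for i
    unfolding ncb_index_def win_def by measurable
  have "(\<lambda>\<omega>. real (cnt (s \<omega>) i) * emp_mean (s \<omega>) i) \<in> borel_measurable \<Omega>" for i
    by measurable
  moreover have "(\<lambda>\<omega>. 420 * ncb_c\<^sup>2 * ln (real (win (s \<omega>)))) \<in> borel_measurable \<Omega>"
    unfolding win_def by measurable
  ultimately have "Measurable.pred \<Omega> (\<lambda>\<omega>. real (cnt (s \<omega>) i) * emp_mean (s \<omega>) i
      \<le> 420 * ncb_c\<^sup>2 * ln (real (win (s \<omega>))))" for i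
    unfolding pred_def by (rule borel_measurable_le)
  then have "Measurable.pred \<Omega> (\<lambda>\<omega>. phase1_cond k (s \<omega>))"
    unfolding phase1_cond_ball by (intro pred_intros_countable(1) pred_intros_logic(4)) simp_all
  then show phase1: "Measurable.pred \<Omega> (\<lambda>\<omega>. in_phase1 k (s \<omega>))"
    unfolding in_phase1_def by (intro pred_intros_logic(2,3)) measurable
  have "Measurable.pred \<Omega> (\<lambda>\<omega>. unif_epoch \<omega> e)" for e
    unfolding unif_epoch_def by measurable
  then have epoch: "Measurable.pred \<Omega> (\<lambda>\<omega>. unif_epoch \<omega> (ep (s \<omega>)))"
    by (rule measurable_compose_countable) measurable
  have "Measurable.pred \<Omega> (\<lambda>\<omega>. ncb_index (s \<omega>) j \<le> ncb_index (s \<omega>) i)" for i j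
    unfolding pred_def by (rule borel_measurable_le) measurable
  then have best: "Measurable.pred \<Omega>
      (\<lambda>\<omega>. i < k \<and> (\<forall>j<k. ncb_index (s \<omega>) j \<le> ncb_index (s \<omega>) i))" for i
    by (intro pred_intros_logic(3,4) pred_intros_countable(1)) simp_all
  show "(\<lambda>\<omega>. choose_arm k \<omega> t (s \<omega>)) \<in> measurable \<Omega> (count_space UNIV)"
    unfolding choose_arm_def
  proof (rule measurable_If)
    show "(\<lambda>\<omega>. unif_arm k (\<omega> (ArmU t))) \<in> measurable \<Omega> (count_space UNIV)"
      by measurable
    show "(\<lambda>\<omega>. LEAST i. i < k \<and> (\<forall>j<k. ncb_index (s \<omega>) j \<le> ncb_index (s \<omega>) i))
        \<in> measurable \<Omega> (count_space UNIV)"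
      by (rule measurable_Least) (rule best)
    show "{\<omega> \<in> space \<Omega>. unif_epoch \<omega> (ep (s \<omega>)) \<or> in_phase1 k (s \<omega>)} \<in> events"
      using pred_intros_logic(5)[OF epoch phase1] unfolding pred_def .
  qed
qed

lemma state_measurable_step:
  assumes "state_measurable s"
  shows "state_measurable (\<lambda>\<omega>. step k \<omega> t (s \<omega>))"
proof -
  have ep: "(\<lambda>\<omega>. ep (s \<omega>)) \<in> measurable \<Omega> (count_space UNIV)"
    and pos: "(\<lambda>\<omega>. pos (s \<omega>)) \<in> measurable \<Omega> (count_space UNIV)"
    and cnt: "\<And>i. (\<lambda>\<omega>. cnt (s \<omega>) i) \<in> measurable \<Omega> (count_space UNIV)"
    and sm: "\<And>i. (\<lambda>\<omega>. sm (s \<omega>) i) \<in> borel_measurable \<Omega>"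
    and gcnt: "\<And>i. (\<lambda>\<omega>. gcnt (s \<omega>) i) \<in> measurable \<Omega> (count_space UNIV)"
    using assms by (auto simp: state_measurable_def)
  have rew: "(\<lambda>\<omega>. \<omega> (Rew i (gcnt (s \<omega>) i))) \<in> borel_measurable \<Omega>" for i
    by (rule measurable_coord_at[OF gcnt])
  have "Measurable.pred \<Omega> (\<lambda>\<omega>. Suc (pos (s \<omega>)) = 2 ^ e)" for e
    by (rule measurable_compose[OF pos, where g = "\<lambda>n. Suc n = 2 ^ e"]) simp
  then have "Measurable.pred \<Omega> (\<lambda>\<omega>. Suc (pos (s \<omega>)) = win (s \<omega>))"
    unfolding win_def by (rule measurable_compose_countable[OF _ ep])
  then have W: "{\<omega> \<in> space \<Omega>. Suc (pos (s \<omega>)) = win (s \<omega>)} \<in> events"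
    by (simp add: pred_def)
  have "Measurable.pred \<Omega> (\<lambda>\<omega>. choose_arm k \<omega> t (s \<omega>) = i)" for i
    by (rule measurable_compose[OF measurable_policy(2)[OF assms], where g = "\<lambda>a. a = i"]) simp
  then have A: "{\<omega> \<in> space \<Omega>. choose_arm k \<omega> t (s \<omega>) = i} \<in> events" for i
    by (simp add: pred_def)
  have Suc: "(\<lambda>\<omega>. Suc (f \<omega>)) \<in> measurable \<Omega> (count_space UNIV)"
    if "f \<in> measurable \<Omega> (count_space UNIV)" for f
    using that by (rule measurable_compose) simp
  have upd: "(\<lambda>\<omega>. f \<omega> + of_bool (choose_arm k \<omega> t (s \<omega>) = i)) \<in> measurable \<Omega> (count_space UNIV)"
    if "f \<in> measurable \<Omega> (count_space UNIV)" for f :: "_ \<Rightarrow> nat" and i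
  proof -
    have "(\<lambda>\<omega>. f \<omega> + of_bool (choose_arm k \<omega> t (s \<omega>) = i))
      = (\<lambda>\<omega>. if choose_arm k \<omega> t (s \<omega>) = i then Suc (f \<omega>) else f \<omega>)"
      by auto
    then show ?thesis using measurable_If[OF Suc[OF that] that A] by simp
  qed
  show ?thesis
    unfolding state_measurable_def step_sel
    by (intro conjI allI measurable_If W A ep pos cnt gcnt upd Suc borel_measurable_add sm rew
        pred_intros_logic(2,3) measurable_policy(1)[OF assms] measurable_const)
      (use W in \<open>simp_all add: pred_def\<close>)
qed

lemma state_measurable_state_at: "state_measurable (\<lambda>\<omega>. state_at k \<omega> t)"
proof (induction t)
  case 0
  then show ?case by (simp add: state_measurable_def)
next
  case (Suc t)
  then show ?case using state_measurable_step by simp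
qed

lemma measurable_pulled[measurable]: "(\<lambda>\<omega>. pulled k \<omega> t) \<in> measurable \<Omega> (count_space UNIV)"
  unfolding pulled_def by (rule measurable_policy[OF state_measurable_state_at])

lemma integrable_pulled: "integrable \<Omega> (\<lambda>\<omega>. \<mu> (pulled k \<omega> t))"
proof (rule integrable_const_bound[where B = 1])
  show "AE \<omega> in \<Omega>. norm (\<mu> (pulled k \<omega> t)) \<le> 1"
    using arm_mean_bounds[OF pulled_less] by (intro AE_I2) auto
qed measurable

end

section \<open>Expected regret\<close>

context bandit
begin

section \<open>Probability that an epoch is not good\<close>

lemma prob_not_two_sided:
  fixes s :: "nat \<Rightarrow> src" and f :: "real \<Rightarrow> real"
  assumes s: "inj s" and f[measurable]: "f \<in> borel_measurable borel"
    and bnd: "\<And>j. AE \<omega> in \<Omega>. f (\<omega> (s j)) \<in> {0..1}"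
    and mean: "\<And>j. expectation (\<lambda>\<omega>. f (\<omega> (s j))) = p"
    and l: "0 \<le> l" "l \<le> 1"
  shows "prob {\<omega>. \<not> two_sided l L (\<Sum>j<n. f (\<omega> (s j))) (n * p)} \<le> 2 * exp (- (6 * L))"
proof -
  let ?U = "{\<omega>. l * (\<Sum>j<n. f (\<omega> (s j))) > (l + l\<^sup>2) * (n * p) + 6 * L}"
  let ?D = "{\<omega>. - l * (\<Sum>j<n. f (\<omega> (s j))) > (l\<^sup>2 / 2 - l) * (n * p) + 6 * L}"
  have eq: "{\<omega>. \<not> two_sided l L (\<Sum>j<n. f (\<omega> (s j))) (n * p)} = ?U \<union> ?D"
    by (auto simp: two_sided_def algebra_simps)
  have "{\<omega> \<in> space \<Omega>. l * (\<Sum>j<n. f (\<omega> (s j))) > (l + l\<^sup>2) * (n * p) + 6 * L} \<in> events"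
    by measurable
  moreover have "{\<omega> \<in> space \<Omega>. - l * (\<Sum>j<n. f (\<omega> (s j))) > (l\<^sup>2 / 2 - l) * (n * p) + 6 * L} \<in> events"
    by measurable
  ultimately have "prob (?U \<union> ?D) \<le> prob ?U + prob ?D"
    by (intro measure_Un_le) simp_all
  moreover have "prob ?U \<le> exp (- (6 * L))"
    by (rule coords_exponential_Markov[OF s f bnd mean exp_le_chord_upper[OF l]])
  moreover have "prob ?D \<le> exp (- (6 * L))"
    by (rule coords_exponential_Markov[OF s f bnd mean exp_le_chord_lower[OF l(1)]])
  ultimately show ?thesis unfolding eq by linarith
qed

lemma reward_bad_eq:
  "{\<omega>. \<not> reward_good e \<omega>} = (\<Union>i\<in>{..<k}. \<Union>g\<in>{..<2 ^ e}. \<Union>n\<in>{..2 ^ e}. \<Union>l\<in>tilts (ln (2 ^ e)) n (\<mu> i).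
     {\<omega>. \<not> two_sided l (ln (2 ^ e)) (\<Sum>j<n. \<omega> (Rew i (g + j))) (n * \<mu> i)})"
  by (auto simp: reward_good_def)

lemma reward_event[measurable]:
  "{\<omega>. \<not> two_sided l L (\<Sum>j<n. \<omega> (Rew i (g + j))) m} \<in> events"
proof -
  have "{\<omega> \<in> space \<Omega>. \<not> two_sided l L (\<Sum>j<n. \<omega> (Rew i (g + j))) m} \<in> events"
    by measurable
  then show ?thesis by simp
qed

lemma reward_bad_event[measurable]: "{\<omega>. \<not> reward_good e \<omega>} \<in> events"
  unfolding reward_bad_eq by (intro sets.finite_UN finite_tilts reward_event) auto

text \<open>With W = 2^e, the union bound ranges over k arms, W offsets, W + 1 lengths, at most 3
  tilts and 2 tails, each failing with probability at most W^(-6).\<close>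

lemma prob_reward_bad: "prob {\<omega>. \<not> reward_good e \<omega>} \<le> 12 * real k / (2 ^ e) ^ 4"
proof -
  define W :: real where "W = 2 ^ e"
  let ?b = "2 * exp (- (6 * ln (2 ^ e :: real)))"
  let ?A = "\<lambda>i g n l. {\<omega>. \<not> two_sided l (ln (2 ^ e)) (\<Sum>j<n. \<omega> (Rew i (g + j))) (n * \<mu> i)}"
  have W1: "1 \<le> W" by (simp add: W_def)
  have one: "prob (?A i g n l) \<le> ?b" if "i < k" "l \<in> tilts (ln (2 ^ e)) n (\<mu> i)" for i g n l
  proof (rule prob_not_two_sided[where s = "\<lambda>j. Rew i (g + j)" and f = "\<lambda>x. x"])
    show "inj (\<lambda>j. Rew i (g + j))" by (auto simp: inj_def)
    show "0 \<le> l" "l \<le> 1"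
      using that arm_mean_bounds[OF that(1)] by (auto simp: tilts_def)
  qed (use that(1) AE_reward expectation_reward in auto)
  have b1: "prob (\<Union>l\<in>tilts (ln (2 ^ e)) n (\<mu> i). ?A i g n l) \<le> 3 * ?b" if "i < k" for i g n
  proof -
    have "prob (\<Union>l\<in>tilts (ln (2 ^ e)) n (\<mu> i). ?A i g n l) \<le> card (tilts (ln (2 ^ e)) n (\<mu> i)) * ?b"
      by (rule prob_UN_le_card[OF finite_tilts]) (use one that in auto)
    also have "\<dots> \<le> 3 * ?b"
      using card_tilts[of "ln (2 ^ e)" n "\<mu> i"] by (intro mult_right_mono) auto
    finally show ?thesis .
  qed
  have b2: "prob (\<Union>n\<in>{..2 ^ e}. \<Union>l\<in>tilts (ln (2 ^ e)) n (\<mu> i). ?A i g n l)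
      \<le> card {..2 ^ e :: nat} * (3 * ?b)" if "i < k" for i g
    by (rule prob_UN_le_card) (use b1 that in \<open>auto intro!: sets.finite_UN finite_tilts reward_event\<close>)
  have b3: "prob (\<Union>g\<in>{..<2 ^ e}. \<Union>n\<in>{..2 ^ e}. \<Union>l\<in>tilts (ln (2 ^ e)) n (\<mu> i). ?A i g n l)
      \<le> card {..<2 ^ e :: nat} * (card {..2 ^ e :: nat} * (3 * ?b))" if "i < k" for i
    by (rule prob_UN_le_card) (use b2 that in \<open>auto intro!: sets.finite_UN finite_tilts reward_event\<close>)
  have "prob {\<omega>. \<not> reward_good e \<omega>}
      \<le> card {..<k} * (card {..<2 ^ e :: nat} * (card {..2 ^ e :: nat} * (3 * ?b)))"
    unfolding reward_bad_eq
    by (rule prob_UN_le_card) (use b3 in \<open>auto intro!: sets.finite_UN finite_tilts reward_event\<close>)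
  also have "\<dots> = 6 * real k * W * (W + 1) / W ^ 6"
    by (simp add: exp_6_ln W_def add.commute)
  also have "\<dots> \<le> 6 * real k * W * (2 * W) / W ^ 6"
    using W1 by (intro divide_right_mono mult_left_mono) auto
  also have "\<dots> = 12 * real k / W ^ 4"
    using W1 by (simp add: field_simps eval_nat_numeral)
  finally show ?thesis by (simp add: W_def)
qed

lemma arm_bad_eq:
  "{\<omega>. \<not> arm_good e \<omega>} = (\<Union>i\<in>{..<k}. \<Union>n\<in>{..2 ^ e}. {\<omega>. \<not> two_sided 1 (ln (2 ^ e))
     (\<Sum>j<n. of_bool (unif_arm k (\<omega> (ArmU (epoch_time e + j))) = i)) (n / k)})"
  by (auto simp: arm_good_def)

lemma arm_event[measurable]:
  "{\<omega>. \<not> two_sided l L (\<Sum>j<n. of_bool (unif_arm k (\<omega> (ArmU (t + j))) = i)) m} \<in> events"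
proof -
  have "{\<omega> \<in> space \<Omega>. \<not> two_sided l L (\<Sum>j<n. of_bool (unif_arm k (\<omega> (ArmU (t + j))) = i)) m} \<in> events"
    unfolding of_bool_def by measurable
  then show ?thesis by simp
qed

lemma arm_bad_event[measurable]: "{\<omega>. \<not> arm_good e \<omega>} \<in> events"
  unfolding arm_bad_eq by (intro sets.finite_UN arm_event) auto

lemma prob_arm_bad: "prob {\<omega>. \<not> arm_good e \<omega>} \<le> 4 * real k / (2 ^ e) ^ 4"
proof -
  define W :: real where "W = 2 ^ e"
  let ?b = "2 * exp (- (6 * ln (2 ^ e :: real)))"
  let ?A = "\<lambda>i n. {\<omega>. \<not> two_sided 1 (ln (2 ^ e))
     (\<Sum>j<n. of_bool (unif_arm k (\<omega> (ArmU (epoch_time e + j))) = i)) (n / k)}"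
  have W1: "1 \<le> W" by (simp add: W_def)
  have b1: "prob (?A i n) \<le> ?b" if "i < k" for i n
  proof -
    have ev: "{\<omega>. unif_arm k (\<omega> (ArmU t)) = i} \<in> events" for t
    proof -
      have "{\<omega> \<in> space \<Omega>. unif_arm k (\<omega> (ArmU t)) = i} \<in> events" by measurable
      then show ?thesis by simp
    qed
    have "expectation (\<lambda>\<omega>. of_bool (unif_arm k (\<omega> (ArmU t)) = i)) = 1 / real k" for t
    proof -
      have "(\<lambda>\<omega>. of_bool (unif_arm k (\<omega> (ArmU t)) = i) :: real)
        = indicator {\<omega>. unif_arm k (\<omega> (ArmU t)) = i}"
        by (auto simp: indicator_def)
      then show ?thesis using prob_unif_arm[OF that, of t] ev[of t] by simp
    qed
    moreover have "(\<lambda>u. of_bool (unif_arm k u = i) :: real) \<in> borel_measurable borel"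
      unfolding of_bool_def by measurable
    ultimately have "prob {\<omega>. \<not> two_sided 1 (ln (2 ^ e))
     (\<Sum>j<n. of_bool (unif_arm k (\<omega> (ArmU (epoch_time e + j))) = i)) (n * (1 / k))} \<le> ?b"
      by (intro prob_not_two_sided[where s = "\<lambda>j. ArmU (epoch_time e + j)"
            and f = "\<lambda>u. of_bool (unif_arm k u = i)"]) (auto simp: inj_def)
    then show ?thesis by simp
  qed
  have b2: "prob (\<Union>n\<in>{..2 ^ e}. ?A i n) \<le> card {..2 ^ e :: nat} * ?b" if "i < k" for i
    by (rule prob_UN_le_card) (use b1 that in \<open>auto intro!: arm_event simp del: sum_of_bool_eq\<close>)
  have "prob {\<omega>. \<not> arm_good e \<omega>} \<le> card {..<k} * (card {..2 ^ e :: nat} * ?b)"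
    unfolding arm_bad_eq
    by (rule prob_UN_le_card) (use b2 in \<open>auto intro!: sets.finite_UN arm_event simp del: sum_of_bool_eq\<close>)
  also have "\<dots> = 2 * real k * (W + 1) / W ^ 6"
    by (simp add: exp_6_ln W_def add.commute)
  also have "\<dots> \<le> 2 * real k * (2 * W) / W ^ 6"
    using W1 by (intro divide_right_mono mult_left_mono) auto
  also have "\<dots> = 4 * real k / W ^ 4 * (1 / W)"
    using W1 by (simp add: field_simps eval_nat_numeral)
  \<comment> \<open>The fixed offset saves a power of \<open>W\<close>, given away to match the
    bound for the rewards.\<close>
  also have "\<dots> \<le> 4 * real k / W ^ 4" using W1 by (intro mult_left_le) auto
  finally show ?thesis by (simp add: W_def)
qed

section \<open>Expected regret per epoch and in total\<close>

definition gap :: "nat \<Rightarrow> real" where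
  "gap t = \<mu>s - expectation (\<lambda>\<omega>. \<mu> (pulled k \<omega> t))"

lemma gap_nonneg: "0 \<le> gap t"
proof -
  have "expectation (\<lambda>\<omega>. \<mu> (pulled k \<omega> t)) \<le> expectation (\<lambda>\<omega>. \<mu>s)"
    by (rule integral_mono[OF integrable_pulled]) (auto intro: arm_mean_le_opt pulled_less)
  then show ?thesis by (simp add: gap_def prob_space)
qed

text \<open>Off the good event the epoch loses at most its length W, and this event has probability
  at most 1/W^2 + 16 k/W^4. In particular, the uniform mode adds at most 1 in expectation.\<close>

lemma expected_epoch_regret:
  "(\<Sum>n<2 ^ e. gap (epoch_time e + n))
     \<le> 15156 * real k * ln (2 ^ e) + 40 * sqrt (ln (2 ^ e) * k * 2 ^ e) + 18 * real k"
proof -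
  define W :: real where "W = 2 ^ e"
  define X where "X = (\<lambda>\<omega>. \<Sum>n<2 ^ e. \<mu>s - \<mu> (pulled k \<omega> (epoch_time e + n)))"
  define D where "D = 15156 * real k * ln (2 ^ e) + 1 + 40 * sqrt (ln (2 ^ e) * k * 2 ^ e)"
  define Bad where "Bad = {\<omega>. unif_epoch \<omega> e} \<union> ({\<omega>. \<not> reward_good e \<omega>} \<union> {\<omega>. \<not> arm_good e \<omega>})"
  have W1: "1 \<le> W" by (simp add: W_def)
  have U: "{\<omega>. unif_epoch \<omega> e} \<in> events"
  proof -
    have "{\<omega> \<in> space \<Omega>. unif_epoch \<omega> e} \<in> events" unfolding unif_epoch_def by measurable
    then show ?thesis by simp
  qed
  have Bad[measurable]: "Bad \<in> events"
    unfolding Bad_def using U by (intro sets.Un) auto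
  have D0: "0 \<le> D" unfolding D_def by (intro add_nonneg_nonneg) auto
  note ind = integrable_indicator_event[OF Bad]
  have intr: "integrable \<Omega> (\<lambda>\<omega>. \<mu>s - \<mu> (pulled k \<omega> t))" for t
    using integrable_pulled by simp
  \<comment> \<open>The rewards lie in [0,1] only almost surely; countably many table entries permit
    a common null set.\<close>
  have "AE \<omega> in \<Omega>. \<forall>i j. i < k \<longrightarrow> \<omega> (Rew i j) \<in> {0..1}"
    unfolding AE_all_countable using AE_reward by auto
  then have AE: "AE \<omega> in \<Omega>. X \<omega> \<le> D + W * indicator Bad \<omega>"
  proof eventually_elim
    case (elim \<omega>)
    show ?case
    proof (cases "\<omega> \<in> Bad")
      case True
      have "X \<omega> \<le> (\<Sum>n<2 ^ e :: nat. 1)"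
        unfolding X_def
      proof (rule sum_mono)
        show "\<mu>s - \<mu> (pulled k \<omega> (epoch_time e + n)) \<le> 1" for n
          using opt_mean_bounds(2) arm_mean_bounds(1)[OF pulled_less, of \<omega> "epoch_time e + n"] by linarith
      qed
      then show ?thesis using True D0 by (simp add: W_def)
    next
      case False
      then interpret good_epoch k \<nu> \<omega> e
        using elim by unfold_locales (auto simp: Bad_def)
      show ?thesis using epoch_regret[of "2 ^ e"] False
        by (simp add: X_def D_def L_def)
    qed
  qed
  have "(\<Sum>n<2 ^ e. gap (epoch_time e + n)) = expectation X"
    unfolding X_def gap_def using integrable_pulled
    by (subst Bochner_Integration.integral_sum) (auto simp: prob_space)
  also have "\<dots> \<le> expectation (\<lambda>\<omega>. D + W * indicator Bad \<omega>)"
    by (rule integral_mono_AE[OF _ _ AE])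
       (auto simp: X_def intro!: intr ind)
  also have "\<dots> = D + W * prob Bad"
    using ind Bad by simp
  also have "prob Bad \<le> 1 / W\<^sup>2 + (12 * real k / W ^ 4 + 4 * real k / W ^ 4)"
  proof -
    have "prob Bad \<le> prob {\<omega>. unif_epoch \<omega> e} + prob ({\<omega>. \<not> reward_good e \<omega>} \<union> {\<omega>. \<not> arm_good e \<omega>})"
      unfolding Bad_def using U by (intro measure_Un_le) auto
    also have "prob ({\<omega>. \<not> reward_good e \<omega>} \<union> {\<omega>. \<not> arm_good e \<omega>})
      \<le> prob {\<omega>. \<not> reward_good e \<omega>} + prob {\<omega>. \<not> arm_good e \<omega>}"
      by (intro measure_Un_le) auto
    finally show ?thesis
      using prob_unif_epoch[of e] prob_reward_bad[of e] prob_arm_bad[of e] by (simp add: W_def)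
  qed
  also have "D + W * (1 / W\<^sup>2 + (12 * real k / W ^ 4 + 4 * real k / W ^ 4)) = D + 1 / W + 16 * real k * (1 / W ^ 3)"
    using W1 by (simp add: field_simps eval_nat_numeral)
  also have "\<dots> \<le> D + 1 + 16 * real k * 1"
  proof -
    have "1 / W ^ 3 \<le> 1" using W1 by (simp add: one_le_power)
    then have "16 * real k * (1 / W ^ 3) \<le> 16 * real k * 1" by (intro mult_left_mono) auto
    moreover have "1 / W \<le> 1" using W1 by simp
    ultimately show ?thesis by linarith
  qed
  \<comment> \<open>The summand 1 inside \<open>D\<close>, the other 1 and
    \<open>16 * real k\<close> are merged using \<open>1 \<le> k\<close>.\<close>
  also have "\<dots> \<le> 15156 * real k * ln (2 ^ e) + 40 * sqrt (ln (2 ^ e) * k * 2 ^ e) + 18 * real k"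
    using k_pos by (simp add: D_def)
  finally show ?thesis using W1 by simp
qed

lemma sum_gap_epochs:
  "(\<Sum>t<epoch_time e. gap t)
     \<le> (\<Sum>e'<e. 15156 * real k * ln (2 ^ e') + 40 * sqrt (ln (2 ^ e') * k * 2 ^ e') + 18 * real k)"
proof (induction e)
  case 0
  then show ?case by (simp add: epoch_time_def)
next
  case (Suc e)
  have "epoch_time (Suc e) = epoch_time e + 2 ^ e"
    using epoch_time_less[of e] by (simp add: epoch_time_def)
  moreover have "(\<Sum>t<a + b. gap t) = (\<Sum>t<a. gap t) + (\<Sum>n<b. gap (a + n))" for a b
    by (induction b) auto
  ultimately have "(\<Sum>t<epoch_time (Suc e). gap t)
    = (\<Sum>t<epoch_time e. gap t) + (\<Sum>n<2 ^ e. gap (epoch_time e + n))"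
    by simp
  then show ?case using Suc expected_epoch_regret[of e] by simp
qed

end

text \<open>The constant 4 survives the induction because 4 + sqrt 2 is at most 4 * sqrt 2, that is,
  4/3 is at most sqrt 2. The last epoch thus dominates, and summing the leading terms costs no
  further logarithm.\<close>

lemma sum_sqrt_power2_le: "(\<Sum>i\<le>n. sqrt (2 ^ i)) \<le> 4 * sqrt (2 ^ n :: real)"
proof (induction n)
  case (Suc n)
  have "4 / 3 \<le> sqrt 2" by (rule real_le_rsqrt) (simp add: power2_eq_square)
  then have "4 / 3 * sqrt (2 ^ n) \<le> sqrt 2 * sqrt (2 ^ n :: real)"
    by (intro mult_right_mono) auto
  moreover have "sqrt (2 ^ Suc n :: real) = sqrt 2 * sqrt (2 ^ n)"
    by (simp add: real_sqrt_mult)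
  ultimately show ?case using Suc unfolding sum.atMost_Suc by linarith
qed simp

context bandit
begin

text \<open>The leading terms grow geometrically, which gives 160 = 40 * 4. The others are bounded
  by their value at \<open>T\<close>, times the number of epochs.\<close>

lemma expected_regret:
  assumes T: "1 \<le> T"
  shows "(\<Sum>t<T. gap t)
     \<le> 160 * sqrt (k * T * ln T) + k * ((2 * ln T + 1) * (15156 * ln T + 18))"
proof -
  obtain E where E: "2 ^ E \<le> T" "T < 2 ^ (E + 1)"
    using ex_power_ivl1[of 2 T] T by auto
  have E': "(2::real) ^ E \<le> T" using E(1) by (metis of_nat_le_iff of_nat_numeral of_nat_power)
  have lnT: "0 \<le> ln (real T)" using T by simp
  have ln: "ln (2 ^ e) \<le> ln (real T)" if "e \<le> E" for e
  proof -
    have "(2::real) ^ e \<le> 2 ^ E" using that by (intro power_increasing) auto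
    then have "(2::real) ^ e \<le> real T" using E' by linarith
    then show ?thesis by (intro ln_mono) (auto intro: less_le_trans[of _ "2 ^ e"])
  qed
  have "real E * (1 / 2) \<le> real E * ln 2"
    using ln2_ge_two_thirds by (intro mult_left_mono) auto
  also have "\<dots> \<le> ln T" using ln[of E] by (simp add: ln_realpow)
  finally have EL: "real (Suc E) \<le> 2 * ln T + 1" by simp
  \<comment> \<open>The epoch running at \<open>T\<close> is completed, which only adds nonnegative
    gaps; its window is still at most \<open>T\<close>.\<close>
  have "(\<Sum>t<T. gap t) \<le> (\<Sum>t<epoch_time (Suc E). gap t)"
    using E(2) gap_nonneg by (intro sum_mono2) (auto simp: epoch_time_def)
  also have "\<dots> \<le> (\<Sum>e<Suc E. 15156 * real k * ln (2 ^ e) + 40 * sqrt (ln (2 ^ e) * k * 2 ^ e) + 18 * real k)"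
    by (rule sum_gap_epochs)
  also have "\<dots> \<le> (\<Sum>e<Suc E. k * (15156 * ln T + 18) + 40 * sqrt (k * ln T) * sqrt (2 ^ e))"
  proof (rule sum_mono)
    fix e assume "e \<in> {..<Suc E}"
    then have l: "ln (2 ^ e) \<le> ln (real T)" by (intro ln) auto
    have "ln (2 ^ e) * k * 2 ^ e \<le> k * ln T * 2 ^ e"
      using l by (simp add: mult.commute mult_left_mono)
    then have "sqrt (ln (2 ^ e) * k * 2 ^ e) \<le> sqrt (k * ln T) * sqrt (2 ^ e)"
      by (simp only: real_sqrt_mult[symmetric] real_sqrt_le_mono)
    moreover have "15156 * real k * ln (2 ^ e) \<le> 15156 * real k * ln T"
      using l by (intro mult_left_mono) auto
    ultimately show "15156 * real k * ln (2 ^ e) + 40 * sqrt (ln (2 ^ e) * k * 2 ^ e) + 18 * real k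
      \<le> k * (15156 * ln T + 18) + 40 * sqrt (k * ln T) * sqrt (2 ^ e)"
      by (simp add: algebra_simps)
  qed
  also have "\<dots> = real (Suc E) * (k * (15156 * ln T + 18)) + 40 * sqrt (k * ln T) * (\<Sum>e\<le>E. sqrt (2 ^ e))"
    unfolding sum.distrib sum_distrib_left lessThan_Suc_atMost by simp
  also have "\<dots> \<le> (2 * ln T + 1) * (k * (15156 * ln T + 18)) + 40 * sqrt (k * ln T) * (4 * sqrt T)"
  proof (intro add_mono mult_right_mono mult_left_mono EL)
    show "(\<Sum>e\<le>E. sqrt (2 ^ e)) \<le> 4 * sqrt (real T)"
      using sum_sqrt_power2_le[of E] real_sqrt_le_mono[OF E'] by linarith
  qed (use lnT in auto)
  finally show ?thesis by (simp add: real_sqrt_mult mult_ac)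
qed

text \<open>The uniform epochs, of probability 1 / W^2, exist precisely to guarantee this bound.\<close>

lemma expected_mean_lower:
  assumes "t < T"
  shows "\<mu>s / (k * (real T)\<^sup>2) \<le> expectation (\<lambda>\<omega>. \<mu> (pulled k \<omega> t))"
proof -
  obtain b where b: "b < k" "\<mu> b = \<mu>s" by (rule opt_arm_exists)
  \<comment> \<open>Rounds are counted from 0, so these inequalities single out the epoch containing
    round \<open>t\<close>.\<close>
  obtain e where e: "2 ^ e \<le> t + 1" "t + 1 < 2 ^ (e + 1)"
    using ex_power_ivl1[of 2 "t + 1"] by auto
  define n where "n = t - epoch_time e"
  have t: "t = epoch_time e + n" and n: "n < 2 ^ e"
    using e by (auto simp: n_def epoch_time_def)
  let ?A = "{\<omega>. unif_epoch \<omega> e \<and> unif_arm k (\<omega> (ArmU t)) = b}"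
  have A[measurable]: "?A \<in> events"
  proof -
    have "{\<omega> \<in> space \<Omega>. unif_epoch \<omega> e \<and> unif_arm k (\<omega> (ArmU t)) = b} \<in> events"
      unfolding unif_epoch_def by measurable
    then show ?thesis by simp
  qed
  have "2 ^ e \<le> T" using e(1) assms by simp
  then have "(2::real) ^ e \<le> T" by (metis of_nat_le_iff of_nat_numeral of_nat_power)
  then have "((2::real) ^ e)\<^sup>2 \<le> (real T)\<^sup>2" by (intro power_mono) auto
  then have "\<mu>s / (k * (real T)\<^sup>2) \<le> \<mu>s / (k * (2 ^ e)\<^sup>2)"
    using opt_mean_bounds(1) k_pos assms by (intro divide_left_mono mult_left_mono) auto
  also have "\<dots> = expectation (\<lambda>\<omega>. \<mu>s * indicator ?A \<omega>)"
    using prob_unif_epoch_arm[OF b(1), of e t] by simp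
  also have "\<dots> \<le> expectation (\<lambda>\<omega>. \<mu> (pulled k \<omega> t))"
  proof (rule integral_mono[OF _ integrable_pulled])
    show "\<mu>s * indicator ?A \<omega> \<le> \<mu> (pulled k \<omega> t)" for \<omega>
    proof (cases "\<omega> \<in> ?A")
      case True
      then have "pulled k \<omega> t = b"
        using within_epoch(1)[OF n, of k \<omega>] by (simp add: pulled_def choose_arm_def t)
      then show ?thesis using True b by simp
    qed (use arm_mean_bounds[OF pulled_less] in auto)
  qed (simp add: integrable_indicator_event[OF A])
  finally show ?thesis .
qed

section \<open>Nash regret against ordinary regret\<close>

text \<open>The product is normalised by the optimal mean, and its geometric mean is the exponential
  of the averaged logarithms \<open>ln (y t)\<close>. For \<open>\<mu>s = 0\<close> no normalisation
  is possible, but then the regret is at most 0.\<close>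

lemma nash_regret_le_regret:
  assumes T: "3 \<le> T" "k \<le> T"
  shows "nash_regret k \<nu> T \<le> 6 * ln T / T * (\<Sum>t<T. gap t)"
proof (cases "\<mu>s = 0")
  case True
  have "0 \<le> 6 * ln T / T * (\<Sum>t<T. gap t)"
    using T gap_nonneg by (intro mult_nonneg_nonneg sum_nonneg) auto
  moreover have "nash_regret k \<nu> T \<le> 0" unfolding nash_regret_def True by simp
  ultimately show ?thesis by linarith
next
  case False
  then have mu: "0 < \<mu>s" using opt_mean_bounds by simp
  define y where "y t = expectation (\<lambda>\<omega>. \<mu> (pulled k \<omega> t)) / \<mu>s" for t
  have "exp 1 \<le> real T" using exp_le T(1) by (intro order_trans[OF exp_le]) simp
  then have lnT: "1 \<le> ln T" using T by (subst ln_ge_iff) auto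
  have y0: "1 / (k * (real T)\<^sup>2) \<le> y t" if "t < T" for t
    using expected_mean_lower[OF that] mu by (simp add: y_def field_simps)
  have ypos: "0 < y t" if "t < T" for t
    using y0[OF that] T k_pos by (intro less_le_trans[OF _ y0[OF that]]) auto
  have gap: "gap t = \<mu>s * (1 - y t)" for t
    using mu by (simp add: gap_def y_def field_simps)
  have y1: "y t \<le> 1" for t
    using gap_nonneg[of t] mu unfolding gap by (simp add: zero_le_mult_iff)
  have ln_y: "- (6 * ln T * (1 - y t)) \<le> ln (y t)" if t: "t < T" for t
  proof (cases "1 / 2 \<le> y t")
    case True
    \<comment> \<open>Near the optimum the logarithm is linear up to a factor 2, which
      \<open>ln T \<ge> 1\<close> absorbs.\<close>
    have "ln (1 / y t) \<le> 1 / y t - 1" using ypos[OF t] by (intro ln_le_minus_one) auto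
    also have "\<dots> = (1 - y t) * (1 / y t)" using ypos[OF t] by (simp add: field_simps)
    also have "\<dots> \<le> (1 - y t) * 2"
      using True y1[of t] ypos[OF t] by (intro mult_left_mono) (auto simp: field_simps)
    also have "\<dots> \<le> (1 - y t) * (6 * ln T)" using lnT y1[of t] by (intro mult_left_mono) auto
    finally show ?thesis using ypos[OF t] by (simp add: ln_div mult.commute)
  next
    case False
    \<comment> \<open>Far from the optimum only the lower bound from the uniform epochs is
      available. As \<open>k \<le> T\<close>, it gives - ln y at most 3 ln T, and 1 - y exceeds 1/2;
      hence the constant 6.\<close>
    have "- ln (k * (real T)\<^sup>2) = ln (1 / (k * (real T)\<^sup>2))"
      using T k_pos by (simp add: ln_div)
    also have "\<dots> \<le> ln (y t)" using y0[OF t] T k_pos by (intro ln_mono) auto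
    finally have "- ln (k * (real T)\<^sup>2) \<le> ln (y t)" .
    moreover have "ln (k * (real T)\<^sup>2) = ln k + 2 * ln T"
      using T k_pos by (simp add: ln_mult ln_realpow)
    moreover have "ln (real k) \<le> ln T" using T k_pos by (intro ln_mono) auto
    moreover have "6 * ln T * (1 / 2) \<le> 6 * ln T * (1 - y t)"
      using False lnT by (intro mult_left_mono) auto
    ultimately show ?thesis by linarith
  qed
  have "(\<Prod>t<T. expectation (\<lambda>\<omega>. \<mu> (pulled k \<omega> t))) = (\<Prod>t<T. exp (ln \<mu>s + ln (y t)))"
    using ypos mu by (intro prod.cong) (auto simp: exp_add y_def)
  also have "\<dots> = exp (\<Sum>t<T. ln \<mu>s + ln (y t))" by (simp add: exp_sum)
  finally have "(\<Prod>t<T. expectation (\<lambda>\<omega>. \<mu> (pulled k \<omega> t))) powr (1 / T)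
      = exp (1 / T * (\<Sum>t<T. ln \<mu>s + ln (y t)))"
    by (simp add: powr_def)
  also have "1 / T * (\<Sum>t<T. ln \<mu>s + ln (y t)) = ln \<mu>s + 1 / T * (\<Sum>t<T. ln (y t))"
    using T by (simp add: sum.distrib field_simps)
  also have "exp \<dots> = \<mu>s * exp (1 / T * (\<Sum>t<T. ln (y t)))"
    using mu by (simp add: exp_add)
  finally have P: "(\<Prod>t<T. expectation (\<lambda>\<omega>. \<mu> (pulled k \<omega> t))) powr (1 / T)
      = \<mu>s * exp (1 / T * (\<Sum>t<T. ln (y t)))" .
  have "\<mu>s * (1 + 1 / T * (\<Sum>t<T. - (6 * ln T * (1 - y t)))) \<le> \<mu>s * (1 + 1 / T * (\<Sum>t<T. ln (y t)))"
    using mu ln_y by (intro mult_left_mono add_left_mono sum_mono) auto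
  also have "\<dots> \<le> \<mu>s * exp (1 / T * (\<Sum>t<T. ln (y t)))"
    using mu by (intro mult_left_mono exp_ge_add_one_self) auto
  finally have "\<mu>s - \<mu>s * exp (1 / T * (\<Sum>t<T. ln (y t)))
    \<le> \<mu>s - \<mu>s * (1 + 1 / T * (\<Sum>t<T. - (6 * ln T * (1 - y t))))" by simp
  also have "\<dots> = 6 * ln T / T * (\<Sum>t<T. gap t)"
    unfolding gap sum_negf sum_distrib_left[symmetric] by (simp add: algebra_simps)
  finally show ?thesis unfolding nash_regret_def P .
qed

end

text \<open>The polylogarithmic part of the regret bound is absorbed from a round on that depends on
  \<open>k\<close> alone, not on the reward distributions.\<close>

lemma eventually_lower_order:
  "\<forall>\<^sub>F T :: nat in sequentially. real k * ((2 * ln T + 1) * (15156 * ln T + 18)) \<le> sqrt T"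
proof -
  have "((\<lambda>x::real. real k * (((2 * ln x + 1) * (15156 * ln x + 18)) / sqrt x)) \<longlongrightarrow> real k * 0) at_top"
    by (intro tendsto_mult_left) real_asymp
  then have "((\<lambda>x::real. real k * (((2 * ln x + 1) * (15156 * ln x + 18)) / sqrt x)) \<longlongrightarrow> 0) at_top"
    by simp
  then have "\<forall>\<^sub>F x :: real in at_top. real k * (((2 * ln x + 1) * (15156 * ln x + 18)) / sqrt x) < 1"
    by (rule order_tendstoD) simp
  then have "\<forall>\<^sub>F x :: real in at_top. real k * ((2 * ln x + 1) * (15156 * ln x + 18)) \<le> sqrt x"
    using eventually_gt_at_top[of 0] by eventually_elim (simp add: field_simps)
  then show ?thesis
    by (rule eventually_compose_filterlim[OF _ filterlim_real_sequentially])
qed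

theorem theorem3:
  shows "\<exists>C>0. \<forall>k\<ge>1. \<exists>T0::nat. \<forall>\<nu>. bandit_instance k \<nu> \<longrightarrow>
           (\<forall>T\<ge>T0. nash_regret k \<nu> T
                      \<le> C * sqrt (real k * ln (real T) / real T) * ln (real T))"
proof (intro exI[of _ "966 :: real"] conjI allI impI)
  fix k :: nat
  assume k: "1 \<le> k"
  obtain T1 where T1: "\<And>T. T1 \<le> T \<Longrightarrow> real k * ((2 * ln (real T) + 1) * (15156 * ln T + 18)) \<le> sqrt T"
    using eventually_lower_order[of k] unfolding eventually_sequentially by blast
  show "\<exists>T0::nat. \<forall>\<nu>. bandit_instance k \<nu> \<longrightarrow>
           (\<forall>T\<ge>T0. nash_regret k \<nu> T
                      \<le> 966 * sqrt (real k * ln (real T) / real T) * ln (real T))"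
  \<comment> \<open>The 3 ensures \<open>1 \<le> ln T\<close>, \<open>k\<close> is needed for the
    reduction to ordinary regret, and \<open>T1\<close> absorbs the lower-order terms.\<close>
  proof (intro exI[of _ "max T1 (max 3 k)"] allI impI)
    fix \<nu> T
    assume "bandit_instance k \<nu>" and T: "max T1 (max 3 k) \<le> T"
    then interpret bandit k \<nu> using k by unfold_locales
    have T3: "3 \<le> T" "k \<le> T" "T1 \<le> T" "1 \<le> T" using T by auto
    have "exp 1 \<le> real T" using T3(1) by (intro order_trans[OF exp_le]) simp
    then have lnT: "1 \<le> ln T" using T3 by (subst ln_ge_iff) auto
    let ?R = "sqrt (k * T * ln T)"
    have "1 \<le> real k * ln T" using k lnT by (metis mult_mono' mult_1 of_nat_1 of_nat_mono zero_le_one)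
    then have "real T * 1 \<le> real T * (real k * ln T)" by (intro mult_left_mono) auto
    then have "sqrt T \<le> ?R" by (simp add: mult_ac)
    \<comment> \<open>The lower-order terms are at most \<open>sqrt T\<close>, hence at most one
      more \<open>?R\<close> beside the 160; finally 966 = 6 * 161.\<close>
    then have "(\<Sum>t<T. gap t) \<le> 161 * ?R"
      using expected_regret[OF T3(4)] T1[OF T3(3)] by linarith
    then have "6 * ln T / T * (\<Sum>t<T. gap t) \<le> 6 * ln T / T * (161 * ?R)"
      using lnT by (intro mult_left_mono) auto
    also have "\<dots> = 966 * (?R / T) * ln T" by simp
    also have "?R / T = sqrt (real k * ln T / T)"
    proof -
      have "?R / T = sqrt (k * T * ln T / (real T)\<^sup>2)" by (simp add: real_sqrt_divide)
      also have "k * T * ln T / (real T)\<^sup>2 = real k * ln T / T"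
        using T3 by (simp add: power2_eq_square)
      finally show ?thesis .
    qed
    finally show "nash_regret k \<nu> T \<le> 966 * sqrt (real k * ln (real T) / real T) * ln (real T)"
      using nash_regret_le_regret[OF T3(1,2)] by linarith
  qed
qed simp

end
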